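(* Let $\mathbf s$ be a recurrent balanced infinite word with alphabet $\mathcal A$, $|\mathcal A|>2$, having fewer than $|\mathcal A|$ oddities. Then either $\mathbf s$ is episturmian or two distinct letters of $\mathbf s$ have the same frequency.
   Context: Recurrent: every factor occurs infinitely often. Balanced: for any two factors $u,v$ of equal length and any letter $x$, the numbers of occurrences of $x$ in $u$ and $v$ differ by at most 1. A complete return to a factor $u$ is a factor containing exactly two occurrences of $u$, one as prefix and one as suffix. An oddity of a word $\mathbf t$ is an unordered pair $\{w,\tilde w\}$ ($\tilde w$ the reversal of $w$) such that $w$ or $\tilde w$ is a non-palindromic complete return in $\mathbf t$ to some non-empty palindromic factor of $\mathbf t$. An infinite word is episturmian if its set of factors is closed under reversal and for each $n$ it has at most one factor $u$ of length $n$ such that $ux,uy$ are factors for two distinct letters $x,y$. The frequency of a letter $a$ is $\lim_n |\mathbf s_n|_a/n$, $\mathbf s_n$ the length-$n$ prefix. *)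

theory Defs
  imports Complex_Main "HOL-Library.Sublist"
begin

text \<open>
  Infinite words are functions from \<^typ>\<open>nat\<close>, finite words are lists.
\<close>

definition occurs_at :: "'a list \<Rightarrow> (nat \<Rightarrow> 'a) \<Rightarrow> nat \<Rightarrow> bool" where
  "occurs_at u s i \<longleftrightarrow> map s [i..<i + length u] = u"

definition factors :: "(nat \<Rightarrow> 'a) \<Rightarrow> 'a list set" where
  "factors s = {u. \<exists>i. occurs_at u s i}"

definition recurrent :: "(nat \<Rightarrow> 'a) \<Rightarrow> bool" where
  "recurrent s \<longleftrightarrow> (\<forall>u\<in>factors s. infinite {i. occurs_at u s i})"

definition balanced :: "(nat \<Rightarrow> 'a) \<Rightarrow> bool" where
  "balanced s \<longleftrightarrow>
     (\<forall>u\<in>factors s. \<forall>v\<in>factors s. length u = length v \<longrightarrow>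
        (\<forall>x. \<bar>int (count_list u x) - int (count_list v x)\<bar> \<le> 1))"

definition palindrome :: "'a list \<Rightarrow> bool" where
  "palindrome w \<longleftrightarrow> rev w = w"

definition occurrences :: "'a list \<Rightarrow> 'a list \<Rightarrow> nat set" where
  "occurrences u w = {i. i + length u \<le> length w \<and> take (length u) (drop i w) = u}"

text \<open>
  Two occurrences force the prefix and the suffix occurrence to be distinct
  (they may overlap).
\<close>

definition complete_return :: "(nat \<Rightarrow> 'a) \<Rightarrow> 'a list \<Rightarrow> 'a list \<Rightarrow> bool" where
  "complete_return s u w \<longleftrightarrow>
     w \<in> factors s \<and> card (occurrences u w) = 2 \<and> prefix u w \<and> suffix u w"

definition odd_return :: "(nat \<Rightarrow> 'a) \<Rightarrow> 'a list \<Rightarrow> bool" where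
  "odd_return s w \<longleftrightarrow>
     \<not> palindrome w \<and>
     (\<exists>u\<in>factors s. u \<noteq> [] \<and> palindrome u \<and> complete_return s u w)"

definition oddities :: "(nat \<Rightarrow> 'a) \<Rightarrow> 'a list set set" where
  "oddities s = {{w, rev w} | w. odd_return s w \<or> odd_return s (rev w)}"

definition right_special :: "(nat \<Rightarrow> 'a) \<Rightarrow> 'a list \<Rightarrow> bool" where
  "right_special s u \<longleftrightarrow>
     u \<in> factors s \<and>
     (\<exists>x y. x \<noteq> y \<and> u @ [x] \<in> factors s \<and> u @ [y] \<in> factors s)"

definition episturmian :: "(nat \<Rightarrow> 'a) \<Rightarrow> bool" where
  "episturmian s \<longleftrightarrow>
     (\<forall>u\<in>factors s. rev u \<in> factors s) \<and>
     (\<forall>n u v. right_special s u \<and> length u = n \<and> right_special s v \<and> length v = n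
        \<longrightarrow> u = v)"

definition has_frequency :: "(nat \<Rightarrow> 'a) \<Rightarrow> 'a \<Rightarrow> real \<Rightarrow> bool" where
  "has_frequency s a f \<longleftrightarrow>
     (\<lambda>n. real (count_list (map s [0..<n]) a) / real n) \<longlonglongrightarrow> f"

end

theory Submission
  imports Defs "HOL-Library.Infinite_Set"
begin

text \<open>
  Suppose that no two letters have the same frequency. If some letter \<open>a\<close> occurs twice in a row,
  then its runs between other letters have lengths \<open>p\<close> and \<open>p + 1\<close>; deleting \<open>p\<close> letters \<open>a\<close> from
  each run gives a balanced recurrent word \<open>t\<close> in which no letter occurs twice in a row. Odd returns
  to different letters of \<open>t\<close> yield different oddities of \<open>s\<close>, so some letter \<open>x\<close> of \<open>t\<close> has only
  palindromic returns. These have odd length, so \<open>x\<close> has a constant even gap \<open>2m\<close>, and folding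
  \<open>t\<close> at the occurrences of \<open>x\<close> and at the centres of its returns, balance forces every letter of
  \<open>t\<close> to have a constant gap: the only alternative are two strictly alternating letters, which would
  have equal frequency. Hence the letters of \<open>t\<close> form an exact covering system. By the root of unity
  argument of Mirsky and Newman the largest gap is attained twice, here necessarily by \<open>a\<close> and one
  other letter; merging these two and repeating shows that the gaps are \<open>2, 4, 8, \<dots>\<close>. Then \<open>p = 1\<close>
  and \<open>s\<close> is the Fraenkel word, the periodic repetition of a ruler sequence, whose right special
  factors are determined by their length.
\<close>

section \<open>Counting letters in windows\<close>

text \<open>Deleting letters \<open>a\<close> preserves the counts of all other letters, so equal
  counts in \<open>t\<close> give equal frequencies in \<open>s\<close> only for pairs without
  \<open>a\<close>, or if p = 0. This asymmetry shapes the proof. An alternating pair that contains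
  \<open>a\<close> must be refuted differently, by comparing the gaps of its other letter in
  \<open>s\<close>. A constant gap shared by \<open>a\<close> and another letter cannot be refuted
  at all, and exactly this exception saves the covering system from the Mirsky-Newman contradiction;
  if p = 0 there is no exception and no covering system.

  Oddities belonging to different letters differ because the return word found for a letter x begins
  and ends with x, so even the unordered pair remembers x. For x = a the palindrome returned to is
  the run of p + 1 letters \<open>a\<close>, not the single letter.

  The value p = 1 comes from the letter of gap 2 in \<open>t\<close>: between two of its occurrences
  stands either \<open>a\<close> or the letter of gap 4, which gives the gaps p + 2 and 2p + 2 in
  \<open>s\<close>.\<close>

definition cnt :: "(nat \<Rightarrow> 'a) \<Rightarrow> 'a \<Rightarrow> nat \<Rightarrow> nat \<Rightarrow> int" where
  "cnt w c i n = (\<Sum>k<n. of_bool (w (i + k) = c))"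

text \<open>As i and j range over all positions, the one-sided bound is symmetric.\<close>

definition bal :: "(nat \<Rightarrow> 'a) \<Rightarrow> bool" where
  "bal w \<longleftrightarrow> (\<forall>c i j n. cnt w c i n \<le> cnt w c j n + 1)"

definition recur :: "(nat \<Rightarrow> 'a) \<Rightarrow> bool" where
  "recur w \<longleftrightarrow> (\<forall>i n N. \<exists>j\<ge>N. \<forall>k<n. w (j + k) = w (i + k))"

lemma balD: "bal w \<Longrightarrow> cnt w c i n \<le> cnt w c j n + 1"
  by (simp add: bal_def)

lemma recurD: "recur w \<Longrightarrow> \<exists>j\<ge>N. \<forall>k<n. w (j + k) = w (i + k)"
  by (simp add: recur_def)

lemma cnt_0 [simp]: "cnt w c i 0 = 0"
  by (simp add: cnt_def)

lemma cnt_Suc: "cnt w c i (Suc n) = cnt w c i n + of_bool (w (i + n) = c)"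
  by (simp add: cnt_def)

lemma cnt_add: "cnt w c i (m + n) = cnt w c i m + cnt w c (i + m) n"
  by (induction n) (simp_all add: cnt_Suc add.assoc)

lemma cnt_Suc_left: "cnt w c i (Suc n) = of_bool (w i = c) + cnt w c (Suc i) n"
  using cnt_add[of w c i 1 n] by (simp add: cnt_Suc)

lemma cnt_nonneg: "0 \<le> cnt w c i n"
  by (simp add: cnt_def sum_nonneg)

lemma cnt_le: "cnt w c i n \<le> int n"
  by (induction n) (auto simp: cnt_Suc)

lemma cnt_eq_0: "(\<And>k. k < n \<Longrightarrow> w (i + k) \<noteq> c) \<Longrightarrow> cnt w c i n = 0"
  by (simp add: cnt_def)

lemma cnt_all: "(\<And>k. k < n \<Longrightarrow> w (i + k) = c) \<Longrightarrow> cnt w c i n = int n"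
  by (simp add: cnt_def)

lemma cnt_cong: "(\<And>k. k < n \<Longrightarrow> w (i + k) = c \<longleftrightarrow> v (j + k) = c) \<Longrightarrow> cnt w c i n = cnt v c j n"
  by (simp add: cnt_def)

lemma cnt_shift: "cnt (\<lambda>i. w (q + i)) c i n = cnt w c (q + i) n"
  by (simp add: cnt_def add.assoc)

lemma cnt_reflect:
  assumes "\<And>k. k < n \<Longrightarrow> w (i + k) = c \<longleftrightarrow> w (j + (n - Suc k)) = c"
  shows "cnt w c i n = cnt w c j n"
proof -
  have "cnt w c i n = (\<Sum>k<n. of_bool (w (j + (n - Suc k)) = c))"
    unfolding cnt_def by (rule sum.cong) (use assms in auto)
  also have "\<dots> = cnt w c j n"
    unfolding cnt_def by (rule sum.nat_diff_reindex)
  finally show ?thesis .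
qed

lemma cnt_mono:
  assumes "i \<le> j" "j + m \<le> i + n"
  shows "cnt w c j m \<le> cnt w c i n"
proof -
  have "n = (j - i) + (m + (i + n - (j + m)))"
    using assms by simp
  then have "cnt w c i n = cnt w c i (j - i) + (cnt w c j m + cnt w c (j + m) (i + n - (j + m)))"
    using assms(1) by (metis cnt_add le_add_diff_inverse)
  then show ?thesis
    using cnt_nonneg[of w c i "j - i"] cnt_nonneg[of w c "j + m" "i + n - (j + m)"] by linarith
qed

lemma cnt_two:
  assumes "w i = c" "w (i + g) = c" "g > 0"
  shows "2 \<le> cnt w c i (Suc g)"
proof -
  have "cnt w c i 1 \<le> cnt w c i g"
    using assms(3) by (intro cnt_mono) auto
  then show ?thesis
    using assms by (simp add: cnt_Suc)
qed

text \<open>A window of length \<open>Suc g\<close> with two occurrences exists, so balance leaves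
  at least one in every window of that length. In this form balance locates letters throughout the
  folding arguments.\<close>

lemma bal_window:
  assumes "bal w" "w i = c" "w (i + g) = c" "g > 0"
  shows "\<exists>k\<le>g. w (j + k) = c"
proof (rule ccontr)
  assume "\<not> ?thesis"
  then have "cnt w c j (Suc g) = 0"
    by (intro cnt_eq_0) auto
  then show False
    using balD[OF assms(1), of c i "Suc g" j] cnt_two[OF assms(2-4)] by simp
qed

text \<open>Window counts change by at most one when the window slides, so an imbalance produces
  two windows whose counts differ by exactly 2.\<close>

lemma cnt_le_if_no_diff2:
  assumes "\<And>i j. cnt w c i n \<noteq> cnt w c j n + 2"
  shows "cnt w c i n \<le> cnt w c j n + 1"
proof (rule ccontr)
  let ?f = "\<lambda>k. cnt w c k n"
  assume "\<not> ?thesis"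
  then have *: "?f j + 2 \<le> ?f i" by simp
  have step: "\<bar>?f (Suc k) - ?f k\<bar> \<le> 1" for k
    using cnt_Suc[of w c k n] cnt_Suc_left[of w c k n] by (auto simp: of_bool_def split: if_splits)
  have "\<exists>k. ?f k = ?f j + 2"
  proof (cases "i \<le> j")
    case True
    \<comment> \<open>The discrete intermediate value theorem wants the left value below the target;
      from i to j the count descends, hence the negation.\<close>
    have "\<exists>k. i \<le> k \<and> k \<le> j \<and> - ?f k = - (?f j + 2)"
      by (rule nat_intermed_int_val) (use True * step in \<open>auto simp: abs_minus_commute\<close>)
    then obtain k where "- ?f k = - (?f j + 2)" by blast
    then have "?f k = ?f j + 2" by linarith
    then show ?thesis by blast
  next
    case False
    have "\<exists>k. j \<le> k \<and> k \<le> i \<and> ?f k = ?f j + 2"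
      by (rule nat_intermed_int_val) (use False * step in auto)
    then show ?thesis by auto
  qed
  then show False using assms by blast
qed

text \<open>Two windows in the same residue class that both deviate from the block count would add up
  to a deviation of 2.\<close>

lemma period_if_constant_block_count:
  assumes "bal w" "recur w" and blk: "\<And>k. cnt w c (z + k * m) m = n"
  shows "w (i + m) = c \<longleftrightarrow> w i = c"
proof (cases "m = 0")
  case False
  have blks: "cnt w c z (r * m) = int r * n" for r
  proof (induction r)
    case (Suc r)
    have "cnt w c z (Suc r * m) = cnt w c z (r * m) + cnt w c (z + r * m) m"
      using cnt_add[of w c z "r * m" m] by (simp add: add.commute)
    then show ?case using Suc blk[of r] by (simp add: algebra_simps)
  qed simp
  have all: "cnt w c i m = n" for i
  proof (rule ccontr)
    define v where "v = cnt w c i m"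
    assume "cnt w c i m \<noteq> n"
    then have vn: "v \<noteq> n" by (simp add: v_def)
    have near: "cnt w c j m \<le> v + 1" "v \<le> cnt w c j m + 1" for j
      unfolding v_def by (rule balD[OF assms(1)])+
    have vn1: "v = n + 1 \<or> v = n - 1"
      using vn near[of z] blk[of 0] by auto
    define J where "J = {j. cnt w c j m = v}"
    have "\<exists>j\<ge>N. j \<in> J" for N
    proof -
      obtain j where "j \<ge> N" "\<forall>k<m. w (j + k) = w (i + k)"
        using recurD[OF assms(2)] by blast
      then have "cnt w c j m = v"
        unfolding v_def by (intro cnt_cong) simp
      then show ?thesis using \<open>j \<ge> N\<close> by (auto simp: J_def)
    qed
    \<comment> \<open>Infinitely many deviating windows contain two whose distance is a positive
      multiple r of m.\<close>
    then have "infinite J"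
      unfolding infinite_nat_iff_unbounded_le by blast
    moreover have "finite ((\<lambda>j. j mod m) ` J)"
      by (rule finite_subset[of _ "{..<m}"]) (use False in auto)
    ultimately have "\<not> inj_on (\<lambda>j. j mod m) J"
      using finite_imageD by blast
    then obtain x y where "x \<in> J" "y \<in> J" "x \<noteq> y" "x mod m = y mod m"
      by (auto simp: inj_on_def)
    then obtain j k where jk: "j \<in> J" "k \<in> J" "j < k" "j mod m = k mod m"
      by (metis linorder_neqE_nat)
    then have "m dvd k - j" using mod_eq_dvd_iff_nat[of j k m] by simp
    then obtain r where "k - j = m * r" by blast
    then have r: "k = j + r * m" using jk(3) by (simp add: mult.commute)
    then have "r > 0" using jk by (cases r) auto
    then obtain r' where r': "r = Suc r'" by (cases r) auto
    have "cnt w c j (Suc r * m) = cnt w c j (m + r' * m) + cnt w c (j + r * m) m"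
      using cnt_add[of w c j "r * m" m] r' by (simp add: add.commute)
    also have "\<dots> = v + cnt w c (j + m) (r' * m) + v"
      using jk r by (simp add: cnt_add J_def)
    finally have tot: "cnt w c j (Suc r * m) = v + cnt w c (j + m) (r' * m) + v" .
    have cmp: "cnt w c j (Suc r * m) \<le> int (Suc r) * n + 1"
      "int (Suc r) * n \<le> cnt w c j (Suc r * m) + 1"
      using balD[OF assms(1), of c j "Suc r * m" z] balD[OF assms(1), of c z "Suc r * m" j]
        blks[of "Suc r"] by auto
    \<comment> \<open>Compared with the deviating window, every window of length m has count at
      least v - 1 and at most v + 1. So the r - 1 windows between the two deviating ones cannot
      compensate, and r + 1 blocks miss the aligned count by 2.\<close>
    have up: "cnt w c j' (q * m) \<ge> int q * n" if "v = n + 1" for j' q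
    proof (induction q)
      case (Suc q)
      have "cnt w c j' (Suc q * m) = cnt w c j' (q * m) + cnt w c (j' + q * m) m"
        using cnt_add[of w c j' "q * m" m] by (simp add: add.commute)
      then show ?case using Suc near(2)[of "j' + q * m"] that by (simp add: algebra_simps)
    qed simp
    have dn: "cnt w c j' (q * m) \<le> int q * n" if "v = n - 1" for j' q
    proof (induction q)
      case (Suc q)
      have "cnt w c j' (Suc q * m) = cnt w c j' (q * m) + cnt w c (j' + q * m) m"
        using cnt_add[of w c j' "q * m" m] by (simp add: add.commute)
      then show ?case using Suc near(1)[of "j' + q * m"] that by (simp add: algebra_simps)
    qed simp
    show False
      using vn1
    proof
      assume v: "v = n + 1"
      show False using up[OF v, of r' "j + m"] tot cmp(1) v r' by (simp add: algebra_simps)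
    next
      assume v: "v = n - 1"
      show False using dn[OF v, of "j + m" r'] tot cmp(2) v r' by (simp add: algebra_simps)
    qed
  qed
  \<comment> \<open>Sliding the window by one drops \<open>w i\<close> and gains
    \<open>w (i + m)\<close>; as the count stays the same, both or neither are c.\<close>
  have "cnt w c i m + of_bool (w (i + m) = c) = of_bool (w i = c) + cnt w c (Suc i) m"
    using cnt_Suc[of w c i m] cnt_Suc_left[of w c i m] by simp
  then show ?thesis by (auto simp: all of_bool_def split: if_splits)
qed simp

section \<open>Gaps\<close>

definition cgap :: "(nat \<Rightarrow> 'a) \<Rightarrow> 'a \<Rightarrow> nat \<Rightarrow> nat \<Rightarrow> bool" where
  "cgap w c i g \<longleftrightarrow> 0 < g \<and> w i = c \<and> w (i + g) = c \<and> (\<forall>k. 0 < k \<and> k < g \<longrightarrow> w (i + k) \<noteq> c)"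

text \<open>The interior of a gap of length at least g + 2 contains a window of length
  \<open>Suc g\<close> without c, against \<open>bal_window\<close>.\<close>

lemma cgap_le_Suc:
  assumes "bal w" "cgap w c i g" "cgap w c j h"
  shows "h \<le> Suc g"
proof (rule ccontr)
  assume *: "\<not> ?thesis"
  obtain k where k: "k \<le> g" "w (Suc j + k) = c"
    using bal_window[OF assms(1), of i c g "Suc j"] assms(2) by (auto simp: cgap_def)
  have "0 < Suc k \<and> Suc k < h" using k(1) * by simp
  then have "w (j + Suc k) \<noteq> c" using assms(3) unfolding cgap_def by blast
  then show False using k(2) by simp
qed

lemma ex_cgap:
  assumes "w i = c" "w j = c" "i < j"
  shows "\<exists>g. cgap w c i g \<and> i + g \<le> j"
proof -
  define g where "g = (LEAST k. 0 < k \<and> w (i + k) = c)"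
  have P: "0 < j - i \<and> w (i + (j - i)) = c" using assms by simp
  have "0 < g \<and> w (i + g) = c" unfolding g_def by (rule LeastI[of _ "j - i"]) (use P in auto)
  moreover have "g \<le> j - i" unfolding g_def by (rule Least_le) (use P in auto)
  moreover have "w (i + k) \<noteq> c" if "0 < k" "k < g" for k
    using not_less_Least[of k "\<lambda>k. 0 < k \<and> w (i + k) = c"] that by (auto simp: g_def)
  ultimately show ?thesis using assms by (auto simp: cgap_def)
qed

lemma recur_letter:
  assumes "recur w"
  shows "\<exists>j\<ge>N. w j = w i"
  using recurD[OF assms, of N 1 i] by auto

text \<open>The gaps directly produce only the occurrences from q onwards. Blocks starting there
  contain c once each, so the indicator of c is periodic, which carries the pattern back to the
  positions before q.\<close>

lemma residue_class_if_constant_gap: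
  assumes "bal w" "recur w" "w q = c" "g > 0" and gap: "\<And>i h. cgap w c i h \<Longrightarrow> h = g"
  shows "w i = c \<longleftrightarrow> i mod g = q mod g"
proof -
  have nxt: "cgap w c j g" if wj: "w j = c" for j
  proof -
    obtain k where "k \<ge> Suc j" "w k = c"
      using recur_letter[OF assms(2), of "Suc j" j] wj by auto
    then show ?thesis using ex_cgap[of w j c k] wj gap by auto
  qed
  have occ: "w (q + k * g) = c" for k
  proof (induction k)
    case (Suc k)
    then show ?case using nxt[OF Suc] by (simp add: cgap_def add_ac)
  qed (simp add: assms)
  have "cnt w c (q + k * g) g = 1" for k
  proof -
    obtain g' where g': "g = Suc g'" using assms(4) by (cases g) auto
    have "w (Suc (q + k * g) + l) \<noteq> c" if "l < g'" for l
    proof -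
      have "0 < Suc l \<and> Suc l < g" using that g' by simp
      then have "w (q + k * g + Suc l) \<noteq> c"
        using nxt[OF occ[of k]] unfolding cgap_def by blast
      then show ?thesis by simp
    qed
    then have "cnt w c (Suc (q + k * g)) g' = 0" by (intro cnt_eq_0)
    then show ?thesis using occ[of k] unfolding g' by (subst cnt_Suc_left) auto
  qed
  then have per: "w (i + g) = c \<longleftrightarrow> w i = c" for i
    by (rule period_if_constant_block_count[OF assms(1,2)])
  have per': "w (i + k * g) = c \<longleftrightarrow> w i = c" for i k
  proof (induction k)
    case (Suc k)
    then show ?case using per[of "i + k * g"] by (simp add: add_ac)
  qed simp
  have red: "w i = c \<longleftrightarrow> w (i mod g) = c" for i
    using per'[of "i mod g" "i div g"] by (simp add: add.commute)
  have q0: "w (q mod g) = c" using red[of q] assms(3) by simp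
  show ?thesis
  proof
    assume "i mod g = q mod g"
    then show "w i = c" using red[of i] q0 by simp
  next
    assume "w i = c"
    then have i0: "w (i mod g) = c" using red by simp
    show "i mod g = q mod g"
    proof (rule ccontr)
      assume "i mod g \<noteq> q mod g"
      then obtain u v where uv: "w u = c" "w v = c" "u < v" "v < g"
        using i0 q0 assms(4) by (metis linorder_neqE_nat mod_less_divisor)
      then show False using ex_cgap[of w u c v] gap by fastforce
    qed
  qed
qed

section \<open>Shifts\<close>

lemma bal_shift: "bal w \<Longrightarrow> bal (\<lambda>i. w (q + i))"
  by (simp add: bal_def cnt_shift)

lemma recur_shift:
  assumes "recur w"
  shows "recur (\<lambda>i. w (q + i))"
  unfolding recur_def
proof (intro allI)
  fix i n N
  obtain j where "j \<ge> q + N" "\<forall>k<n. w (j + k) = w (q + i + k)"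
    using recurD[OF assms] by blast
  then show "\<exists>j\<ge>N. \<forall>k<n. w (q + (j + k)) = w (q + (i + k))"
    by (intro exI[of _ "j - q"]) (auto simp: add.assoc)
qed

lemma cgap_shift: "cgap (\<lambda>i. w (q + i)) c i g \<longleftrightarrow> cgap w c (q + i) g"
  by (simp add: cgap_def add.assoc)

section \<open>Constant gaps from palindromic returns\<close>

lemma mod_double_eq_iff:
  fixes h :: nat
  assumes "h > 0"
  shows "i mod (2 * h) = h \<longleftrightarrow> h dvd i \<and> \<not> 2 * h dvd i"
proof
  assume *: "i mod (2 * h) = h"
  then have "i = 2 * h * (i div (2 * h)) + h" by (metis mult_div_mod_eq)
  then have "i = h * (2 * (i div (2 * h)) + 1)" by (simp add: algebra_simps)
  then have "h dvd i" by (metis dvd_triv_left)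
  with * assms show "h dvd i \<and> \<not> 2 * h dvd i" by (simp add: dvd_eq_mod_eq_0)
next
  assume *: "h dvd i \<and> \<not> 2 * h dvd i"
  then obtain k where k: "i = h * k" by blast
  then have "odd k" using * by auto
  then obtain l where "k = 2 * l + 1" by (metis oddE)
  then have "i = h + l * (2 * h)" using k by (simp add: algebra_simps)
  then have "i mod (2 * h) = h mod (2 * h)" by (metis mod_mult_self1)
  then show "i mod (2 * h) = h" using assms by simp
qed

text \<open>The hypotheses are an invariant: Z owns the multiples of m, and the palindrome between
  them repeats with period m. Its centre m/2 exists, as otherwise two equal letters would meet
  there. Folding at the centre gives every letter outside Z, except the centre letter b, the period
  m/2, so the invariant passes to \<open>insert b Z\<close> and m/2.\<close>

lemma halving_residue_classes:
  assumes "bal w" "recur w" and noloop: "\<And>i. w i \<noteq> w (Suc i)"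
    and "m > 0"
    and "\<And>i. w i \<in> Z \<longleftrightarrow> m dvd i"
    and "\<And>c i. c \<notin> Z \<Longrightarrow> w (i + m) = c \<longleftrightarrow> w i = c"
    and "\<And>i. 0 < i \<Longrightarrow> i < m \<Longrightarrow> w i = w (m - i)"
    and "c \<in> range w" "c \<notin> Z"
  shows "\<exists>d>0. \<exists>r<d. \<forall>i. w i = c \<longleftrightarrow> i mod d = r"
  using assms(4-)
proof (induction m arbitrary: Z rule: less_induct)
  case (less m)
  note Zdvd = less.prems(2) and per = less.prems(3) and refl = less.prems(4)
  have "m \<noteq> 1"
    using Zdvd less.prems(5,6) by auto
  have "even m"
  proof (rule ccontr)
    assume "odd m"
    then obtain h where h: "m = Suc (2 * h)" by (metis oddE Suc_eq_plus1)
    with \<open>m \<noteq> 1\<close> have "w h = w (m - h)" by (intro refl) auto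
    then show False using noloop[of h] h by simp
  qed
  then obtain h where h: "m = 2 * h" by blast
  with less.prems(1) have "h > 0" by simp
  define b where "b = w h"
  define Z' where "Z' = insert b Z"
  have bZ: "b \<notin> Z"
    using Zdvd[of h] h \<open>h > 0\<close> by (auto simp: b_def dest: dvd_imp_le)
  have perk: "w (i + k * m) = d \<longleftrightarrow> w i = d" if "d \<notin> Z" for d i k
  proof (induction k)
    case (Suc k)
    then show ?case using per[OF that, of "i + k * m"] by (simp add: add_ac)
  qed simp
  \<comment> \<open>Reflection at h exchanges the two halves of a block, and neither 0 nor h carries
    d; so both halves contain d equally often.\<close>
  have per': "w (i + h) = d \<longleftrightarrow> w i = d" if "d \<notin> Z'" for d i
  proof (rule period_if_constant_block_count[OF assms(1,2)])
    have dZ: "d \<notin> Z" "d \<noteq> b" using that by (auto simp: Z'_def)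
    obtain h' where h': "h = Suc h'" using \<open>h > 0\<close> by (cases h) auto
    have "cnt w d 1 h' = cnt w d (Suc h) h'"
    proof (rule cnt_reflect)
      fix k assume k: "k < h'"
      then have "m - Suc k = Suc h + (h' - Suc k)" using h h' by simp
      then show "w (1 + k) = d \<longleftrightarrow> w (Suc h + (h' - Suc k)) = d"
        using refl[of "Suc k"] k h h' by simp
    qed
    moreover have "w 0 \<noteq> d" "w h \<noteq> d"
      using dZ Zdvd[of 0] by (auto simp: b_def)
    ultimately have two: "cnt w d h h = cnt w d 0 h"
      by (simp add: h' cnt_Suc_left del: One_nat_def) simp
    fix k
    have "cnt w d (0 + k * h) h = cnt w d ((k mod 2) * h) h"
    proof (rule cnt_cong)
      fix l
      have "k * h = (k mod 2 + 2 * (k div 2)) * h" by simp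
      also have "\<dots> = k mod 2 * h + k div 2 * m" unfolding h by (simp only: algebra_simps)
      finally have "0 + k * h + l = (k mod 2 * h + l) + k div 2 * m" by simp
      then show "w (0 + k * h + l) = d \<longleftrightarrow> w (k mod 2 * h + l) = d"
        using perk[OF dZ(1), of "k mod 2 * h + l" "k div 2"] by argo
    qed
    also have "\<dots> = cnt w d 0 h"
      using two by (cases "even k") (auto simp: even_iff_mod_2_eq_zero odd_iff_mod_2_eq_one)
    finally show "cnt w d (0 + k * h) h = cnt w d 0 h" .
  qed
  have Zper: "w (i + h) \<in> Z' \<longleftrightarrow> w i \<in> Z'" for i
    using per'[of "w i" i] per'[of "w (i + h)" i] by metis
  have Zperk: "w (i + k * h) \<in> Z' \<longleftrightarrow> w i \<in> Z'" for i k
  proof (induction k)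
    case (Suc k)
    then show ?case using Zper[of "i + k * h"] by (simp add: add_ac)
  qed simp
  have empty: "w r \<notin> Z'" if "0 < r" "r < h" for r
  proof (rule ccontr)
    assume ex: "\<not> w r \<notin> Z'"
    define p where "p = (LEAST r. 0 < r \<and> w r \<in> Z')"
    have p: "0 < p \<and> w p \<in> Z'"
      unfolding p_def by (rule LeastI[of _ r]) (use that ex in auto)
    have "p \<le> r" unfolding p_def by (rule Least_le) (use that ex in auto)
    then have ph: "p < h" using that by simp
    have min: "w k \<notin> Z'" if "0 < k" "k < p" for k
      using not_less_Least[of k "\<lambda>r. 0 < r \<and> w r \<in> Z'"] that by (auto simp: p_def)
    have "w (h + p) \<in> Z'" using Zper[of p] p by (simp add: add.commute)
    moreover have "w (h + p) \<notin> Z"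
      using Zdvd[of "h + p"] ph h p by (auto dest: dvd_imp_le)
    ultimately have wb: "w (h + p) = b" by (simp add: Z'_def)
    have p1: "p \<noteq> 1" using wb noloop[of h] by (auto simp: b_def)
    \<comment> \<open>The letter b at h and h + p forces a b into the positions m - p + 1 to m + 1.
      Those below m reflect to 1, ..., p - 1 and are excluded by minimality of p, m carries a letter
      of Z, and m + 1 repeats position 1, which could carry b only if p = 1.\<close>
    obtain k where k: "k \<le> p" "w (m - p + 1 + k) = b"
      using bal_window[OF assms(1), of h b p "m - p + 1"] wb p by (auto simp: b_def)
    consider "k + 1 < p" | "k + 1 = p" | "k = p" using k(1) by linarith
    then show False
    proof cases
      case 1
      have "w (p - 1 - k) = w (m - (p - 1 - k))"
        by (rule refl) (use 1 ph h in auto)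
      also have "m - (p - 1 - k) = m - p + 1 + k" using 1 ph h by simp
      finally show False using k(2) min[of "p - 1 - k"] 1 by (auto simp: Z'_def)
    next
      case 2
      then have "m - p + 1 + k = m" using ph h by simp
      then show False using k(2) Zdvd[of m] bZ by auto
    next
      case 3
      then have "m - p + 1 + k = 1 + m" using ph h by simp
      then have "w 1 = b" using k(2) per[OF bZ, of 1] by simp
      then show False using min[of 1] p p1 by (auto simp: Z'_def)
    qed
  qed
  have Zdvd': "w i \<in> Z' \<longleftrightarrow> h dvd i" for i
  proof -
    have "w i \<in> Z' \<longleftrightarrow> w (i mod h) \<in> Z'"
      using Zperk[of "i mod h" "i div h"] by simp
    also have "\<dots> \<longleftrightarrow> i mod h = 0"
      using empty[of "i mod h"] Zdvd[of 0] \<open>h > 0\<close> by (auto simp: Z'_def)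
    finally show ?thesis by (simp add: dvd_eq_mod_eq_0)
  qed
  show ?case
  proof (cases "c = b")
    case True
    have "w i = b \<longleftrightarrow> i mod m = h" for i
    proof -
      have "w i = b \<longleftrightarrow> h dvd i \<and> \<not> m dvd i"
        using Zdvd'[of i] Zdvd[of i] bZ by (auto simp: Z'_def)
      also have "\<dots> \<longleftrightarrow> i mod m = h"
        using mod_double_eq_iff[OF \<open>h > 0\<close>, of i] unfolding h by simp
      finally show ?thesis .
    qed
    then have "\<forall>i. w i = c \<longleftrightarrow> i mod m = h" using True by blast
    moreover have "0 < m" "h < m" using h \<open>h > 0\<close> by simp_all
    ultimately show ?thesis by blast
  next
    case False
    have refl': "w i = w (h - i)" if "0 < i" "i < h" for i
    proof -
      have "w i = w (m - i)" by (rule refl) (use that h in auto)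
      moreover have "m - i = h - i + h" using that h by simp
      ultimately show ?thesis using per'[of "w i" "h - i"] empty[OF that] by simp
    qed
    have "h < m" "c \<notin> Z'" using h \<open>h > 0\<close> False less.prems(6) by (auto simp: Z'_def)
    then show ?thesis
      using less.IH[of h Z', OF _ \<open>h > 0\<close> Zdvd' per' refl' less.prems(5)] by blast
  qed
qed

section \<open>Pairs of letters that separate each other\<close>

definition alternate :: "(nat \<Rightarrow> 'a) \<Rightarrow> 'a \<Rightarrow> 'a \<Rightarrow> bool" where
  "alternate w u v \<longleftrightarrow> (\<forall>i g. cgap w u i g \<longrightarrow> (\<exists>k. 0 < k \<and> k < g \<and> w (i + k) = v)) \<and>
     (\<forall>i g. cgap w v i g \<longrightarrow> (\<exists>k. 0 < k \<and> k < g \<and> w (i + k) = u))"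

text \<open>Right after an occurrence of u every further u is preceded by a v of its own, so u never
  takes the lead.\<close>

lemma alternate_after:
  assumes "alternate w u v"
  shows "w i = u \<Longrightarrow> cnt w u (Suc i) n \<le> cnt w v (Suc i) n"
proof (induction n arbitrary: i rule: less_induct)
  case (less n)
  show ?case
  proof (cases "\<exists>k<n. w (Suc i + k) = u")
    case False
    then have "cnt w u (Suc i) n = 0" by (intro cnt_eq_0) auto
    then show ?thesis using cnt_nonneg[of w v "Suc i" n] by simp
  next
    case True
    then obtain k where k: "k < n" "w (Suc i + k) = u" by blast
    then obtain g where g: "cgap w u i g" "i + g \<le> Suc i + k"
      using ex_cgap[of w i u "Suc i + k"] less.prems by auto
    then obtain l where l: "0 < l" "l < g" "w (i + l) = v"
      using assms unfolding alternate_def by blast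
    obtain h where h: "g = Suc h" using g(1) by (cases g) (auto simp: cgap_def)
    have split: "cnt w c (Suc i) n = cnt w c (Suc i) h + cnt w c (i + g) 1 + cnt w c (Suc (i + g)) (n - g)" for c
    proof -
      have "n = h + (1 + (n - g))" using g k h by simp
      then have "cnt w c (Suc i) n = cnt w c (Suc i) h + cnt w c (Suc i + h) (1 + (n - g))"
        by (metis cnt_add)
      then show ?thesis using h by (simp add: cnt_add cnt_Suc_left)
    qed
    have "cnt w u (Suc i) h = 0"
    proof (rule cnt_eq_0)
      fix k assume "k < h"
      then have "0 < Suc k \<and> Suc k < g" using h by simp
      then have "w (i + Suc k) \<noteq> u" using g(1) unfolding cgap_def by blast
      then show "w (Suc i + k) \<noteq> u" by simp
    qed
    moreover have "1 \<le> cnt w v (Suc i) h"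
    proof -
      have "cnt w v (i + l) 1 \<le> cnt w v (Suc i) h" using l h by (intro cnt_mono) auto
      then show ?thesis using l by (simp add: cnt_Suc)
    qed
    moreover have "cnt w u (i + g) 1 \<le> 1" using cnt_le[of w u "i + g" 1] by simp
    moreover have "cnt w u (Suc (i + g)) (n - g) \<le> cnt w v (Suc (i + g)) (n - g)"
      by (rule less.IH) (use g k h in \<open>auto simp: cgap_def\<close>)
    moreover have "0 \<le> cnt w v (i + g) 1" by (rule cnt_nonneg)
    ultimately show ?thesis using split[of u] split[of v] by linarith
  qed
qed

lemma alternate_le:
  assumes "alternate w u v"
  shows "cnt w u i n \<le> cnt w v i n + 1"
proof (induction n arbitrary: i)
  case (Suc n)
  show ?case
  proof (cases "w i = u")
    case True
    then show ?thesis
      using alternate_after[OF assms True, of n] by (simp add: cnt_Suc_left)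
  next
    case False
    then show ?thesis using Suc[of "Suc i"] by (simp add: cnt_Suc_left)
  qed
qed simp

lemma alternate_sym: "alternate w u v \<Longrightarrow> alternate w v u"
  by (simp add: alternate_def)

lemma alternate_bounded: "alternate w u v \<Longrightarrow> \<bar>cnt w u i n - cnt w v i n\<bar> \<le> 1"
  using alternate_le[of w u v i n] alternate_le[OF alternate_sym, of w u v i n] by linarith

text \<open>Alternation puts a v into the gap; a second one would need a u between them.\<close>

lemma alternate_cgap_cnt:
  assumes "alternate w u v" "u \<noteq> v" "cgap w u i g"
  shows "cnt w v i g = 1"
proof -
  obtain h where h: "g = Suc h" using assms(3) by (cases g) (auto simp: cgap_def)
  have "cnt w u (Suc i) h = 0"
  proof (rule cnt_eq_0)
    fix k assume "k < h"
    then have "0 < Suc k \<and> Suc k < g" using h by simp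
    then have "w (i + Suc k) \<noteq> u" using assms(3) unfolding cgap_def by blast
    then show "w (Suc i + k) \<noteq> u" by simp
  qed
  then have "cnt w v (Suc i) h \<le> 1" using alternate_le[OF alternate_sym[OF assms(1)], of "Suc i" h] by simp
  moreover obtain l where l: "0 < l" "l < g" "w (i + l) = v"
    using assms unfolding alternate_def by blast
  have "cnt w v (i + l) 1 \<le> cnt w v (Suc i) h" using l h by (intro cnt_mono) auto
  then have "1 \<le> cnt w v (Suc i) h" using l by (simp add: cnt_Suc)
  moreover have "w i \<noteq> v" using assms by (auto simp: cgap_def)
  ultimately show ?thesis using h by (simp add: cnt_Suc_left)
qed

lemma residue_hit:
  assumes "r < (d::nat)"
  shows "\<exists>k<d. (i + k) mod d = r"
proof -
  have "d > 0" using assms by simp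
  let ?k = "(r + (d - i mod d)) mod d"
  have "(i + ?k) mod d = (i mod d + (r + (d - i mod d))) mod d" by (simp add: mod_simps)
  also have "i mod d + (r + (d - i mod d)) = r + d"
    using mod_less_divisor[OF \<open>d > 0\<close>, of i] by linarith
  finally have "(i + ?k) mod d = r" using assms by simp
  then show ?thesis using \<open>d > 0\<close> by (intro exI[of _ ?k]) simp
qed

lemma alternate_if_same_modulus:
  assumes "b \<noteq> c" "rb < d" "rc < d"
    and b: "\<And>i. w i = b \<longleftrightarrow> i mod d = rb" and c: "\<And>i. w i = c \<longleftrightarrow> i mod d = rc"
  shows "alternate w b c"
proof -
  have *: "\<exists>k. 0 < k \<and> k < g \<and> w (i + k) = y"
    if that: "cgap w x i g" "x \<noteq> y" and ry: "ry < d" and x: "\<And>i. w i = x \<longleftrightarrow> i mod d = rx" and y: "\<And>i. w i = y \<longleftrightarrow> i mod d = ry"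
    for x y rx ry i g
  proof -
    have xi: "w i = x" "w (i + g) = x" "0 < g" using that(1) by (auto simp: cgap_def)
    then have "i mod d = (i + g) mod d" using x by simp
    then have "d dvd g" using mod_eq_dvd_iff_nat[of i "i + g" d] by simp
    then have "d \<le> g" using xi(3) by (rule dvd_imp_le)
    obtain k where k: "k < d" "(i + k) mod d = ry" using residue_hit[OF ry] by blast
    have wk: "w (i + k) = y" using y k by simp
    then have "k \<noteq> 0" using xi that(2) by (intro notI) simp
    then show ?thesis using k wk \<open>d \<le> g\<close> by (intro exI[of _ k]) simp
  qed
  show ?thesis unfolding alternate_def
    using *[OF _ assms(1,3) b c] *[OF _ assms(1)[symmetric] assms(2) c b] by blast
qed

text \<open>Near the letter \<open>w x\<close> the letters \<open>u\<close> and \<open>v\<close> both have a gap \<open>2p + 1\<close>, so neither of them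
  fits twice between two consecutive occurrences of the other one.\<close>

lemma alternate_around:
  assumes "bal w" "u \<noteq> v" and gu: "cgap w u i (2 * p)" and gv: "cgap w v j (2 * p)"
    and "p < x" "w (x - p) = u" "w (x + p) = v"
    and mid: "\<And>k. x - p < k \<Longrightarrow> k < x + p \<Longrightarrow> w k \<noteq> u \<and> w k \<noteq> v"
  shows "alternate w u v \<and> cgap w u (x - p) (Suc (2 * p)) \<and> cgap w v (x - p - 1) (Suc (2 * p))"
proof -
  have "p > 0" using gu by (simp add: cgap_def)
  have winu: "\<exists>k\<le>2 * p. w (l + k) = u" for l
    using bal_window[OF assms(1), of i u "2 * p" l] gu by (simp add: cgap_def)
  have winv: "\<exists>k\<le>2 * p. w (l + k) = v" for l
    using bal_window[OF assms(1), of j v "2 * p" l] gv by (simp add: cgap_def)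
  have nou: "w k \<noteq> u" if "x - p < k" "k \<le> x + p" for k
    using mid[of k] that assms(2,7) by (cases "k = x + p") auto
  have nov: "w k \<noteq> v" if "x - p \<le> k" "k < x + p" for k
    using mid[of k] that assms(2,6) by (cases "k = x - p") auto
  \<comment> \<open>Of the 2p + 1 positions after x - p only the last one, x + p + 1, can carry u.
    Symmetrically v is forced to x - p - 1.\<close>
  obtain k where k: "k \<le> 2 * p" "w (x - p + 1 + k) = u" using winu by blast
  have "k = 2 * p"
    using nou[of "x - p + 1 + k"] k assms(5) by (cases "k < 2 * p") auto
  have cu: "cgap w u (x - p) (Suc (2 * p))"
    unfolding cgap_def
  proof (intro conjI allI impI)
    show "w (x - p + Suc (2 * p)) = u" using k \<open>k = 2 * p\<close> by simp
    fix l assume "0 < l \<and> l < Suc (2 * p)"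
    then show "w (x - p + l) \<noteq> u" using assms(5) by (intro nou) auto
  qed (use assms in auto)
  obtain k' where k': "k' \<le> 2 * p" "w (x - p - 1 + k') = v" using winv by blast
  have "k' = 0"
    using nov[of "x - p - 1 + k'"] k' assms(5) by (cases "k' = 0") auto
  have cv: "cgap w v (x - p - 1) (Suc (2 * p))"
    unfolding cgap_def
  proof (intro conjI allI impI)
    show "w (x - p - 1) = v" using k' \<open>k' = 0\<close> by simp
    have "x - p - 1 + Suc (2 * p) = x + p" using assms(5) by simp
    then show "w (x - p - 1 + Suc (2 * p)) = v" using assms(7) by argo
    fix l assume "0 < l \<and> l < Suc (2 * p)"
    then show "w (x - p - 1 + l) \<noteq> v" using assms(5) by (intro nov) auto
  qed simp
  have gapu: "2 * p \<le> g" if "cgap w u l g" for l g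
    using cgap_le_Suc[OF assms(1) that cu] by simp
  have gapv: "2 * p \<le> g" if "cgap w v l g" for l g
    using cgap_le_Suc[OF assms(1) that cv] by simp
  have "alternate w u v"
    unfolding alternate_def
  proof (intro conjI allI impI)
    fix l g assume g: "cgap w u l g"
    obtain k where k: "k \<le> 2 * p" "w (l + k) = v" using winv by blast
    have "k \<noteq> 0" "k \<noteq> g" using k g assms(2) by (auto simp: cgap_def intro!: gr0I)
    then show "\<exists>k. 0 < k \<and> k < g \<and> w (l + k) = v"
      using gapu[OF g] k by (intro exI[of _ k]) auto
  next
    fix l g assume g: "cgap w v l g"
    obtain k where k: "k \<le> 2 * p" "w (l + k) = u" using winu by blast
    have "k \<noteq> 0" "k \<noteq> g" using k g assms(2) by (auto simp: cgap_def intro!: gr0I)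
    then show "\<exists>k. 0 < k \<and> k < g \<and> w (l + k) = u"
      using gapv[OF g] k by (intro exI[of _ k]) auto
  qed
  then show ?thesis using cu cv by simp
qed

text \<open>The centre letter may vary from one return to the next, so Z collects x and all centre
  letters. Letters outside Z have period m by folding. Unless two letters alternate, Z lives only on
  the multiples of m; then \<open>halving_residue_classes\<close> handles the letters outside Z, and
  parity of gaps handles the centre letters.\<close>

lemma residue_classes_if_palindromic_returns:
  assumes B: "bal w" and R: "recur w" and noloop: "\<And>i. w i \<noteq> w (Suc i)"
    and "m > 0" and x: "\<And>i. w i = x \<longleftrightarrow> 2 * m dvd i"
    and refl: "\<And>k r. r \<le> 2 * m \<Longrightarrow> w (2 * m * k + r) = w (2 * m * k + (2 * m - r))"
    and noalt: "\<And>u v g i i' j j'. u \<noteq> v \<Longrightarrow> alternate w u v \<Longrightarrow> cgap w u i g \<Longrightarrow> cgap w u i' (Suc g)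
       \<Longrightarrow> cgap w v j g \<Longrightarrow> cgap w v j' (Suc g) \<Longrightarrow> False"
    and c: "c \<in> range w"
  shows "\<exists>d>0. \<exists>r<d. \<forall>i. w i = c \<longleftrightarrow> i mod d = r"
proof -
  define Z where "Z = range (\<lambda>i. w (m * i))"
  have inZ: "w (m * k) \<in> Z" for k by (auto simp: Z_def)
  have xZ: "x \<in> Z" using inZ[of 0] x[of 0] by simp
  have per: "w (i + m) = d \<longleftrightarrow> w i = d" if dZ: "d \<notin> Z" for d i
  proof (rule period_if_constant_block_count[OF B R])
    have nd: "w (m * k) \<noteq> d" for k using dZ inZ by metis
    obtain h' where h': "m = Suc h'" using \<open>m > 0\<close> by (cases m) auto
    have half: "cnt w d (2 * m * k + m) m = cnt w d (2 * m * k) m" for k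
    proof -
      have "cnt w d (Suc (2 * m * k)) h' = cnt w d (Suc (2 * m * k + m)) h'"
      proof (rule cnt_reflect)
        fix l assume l: "l < h'"
        then have "2 * m * k + (2 * m - Suc l) = Suc (2 * m * k + m) + (h' - Suc l)" using h' by simp
        then show "w (Suc (2 * m * k) + l) = d \<longleftrightarrow> w (Suc (2 * m * k + m) + (h' - Suc l)) = d"
          using refl[of "Suc l" k] l h' by simp
      qed
      moreover have "w (2 * m * k) \<noteq> d" "w (2 * m * k + m) \<noteq> d"
        using nd[of "2 * k"] nd[of "2 * k + 1"] by (simp_all add: algebra_simps)
      ultimately show ?thesis
        using cnt_Suc_left[of w d "2 * m * k" h'] cnt_Suc_left[of w d "2 * m * k + m" h'] h' by simp
    qed
    have full: "cnt w d (2 * m * k) (m + m) = 2 * cnt w d (2 * m * k) m" for k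
      using half[of k] by (simp add: cnt_add)
    \<comment> \<open>The counts over whole returns are even, so a difference of at most 1 is
      none.\<close>
    have eq: "cnt w d (2 * m * k) m = cnt w d 0 m" for k
      using balD[OF B, of d "2 * m * k" "m + m" 0] balD[OF B, of d 0 "m + m" "2 * m * k"]
        full[of k] full[of 0] by simp
    fix k
    show "cnt w d (0 + k * m) m = cnt w d 0 m"
    proof (cases "even k")
      case True
      then obtain l where "k = 2 * l" by blast
      then show ?thesis using eq[of l] by (simp add: algebra_simps)
    next
      case False
      then obtain l where "k = 2 * l + 1" by (metis oddE)
      then show ?thesis using eq[of l] half[of l] by (simp add: algebra_simps)
    qed
  qed
  have Zper: "w (i + m) \<in> Z \<longleftrightarrow> w i \<in> Z" for i
    using per[of "w i" i] per[of "w (i + m)" i] by metis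
  have Zperk: "w (i + k * m) \<in> Z \<longleftrightarrow> w i \<in> Z" for i k
  proof (induction k)
    case (Suc k)
    then show ?case using Zper[of "i + k * m"] by (simp add: add_ac)
  qed simp
  have Zrefl: "w (m - r) \<in> Z \<longleftrightarrow> w r \<in> Z" if "r \<le> m" for r
  proof -
    have "w r = w (2 * m - r)" using refl[of r 0] that by simp
    moreover have "2 * m - r = (m - r) + m" using that by simp
    ultimately show ?thesis using Zper[of "m - r"] by simp
  qed
  have empty: "w r \<notin> Z" if "0 < r" "r < m" for r
  proof (rule ccontr)
    assume ex: "\<not> w r \<notin> Z"
    define p where "p = (LEAST r. 0 < r \<and> w r \<in> Z)"
    have p: "0 < p \<and> w p \<in> Z"
      unfolding p_def by (rule LeastI[of _ r]) (use that ex in auto)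
    have "p \<le> r" unfolding p_def by (rule Least_le) (use that ex in auto)
    then have pm: "p < m" using that by simp
    have min: "w k \<notin> Z" if "0 < k" "k < p" for k
      using not_less_Least[of k "\<lambda>r. 0 < r \<and> w r \<in> Z"] that by (auto simp: p_def)
    have near: "w i \<notin> Z" if "k * m - p < i" "i < k * m + p" "i \<noteq> k * m" "k > 0" for i k
    proof (cases "i < k * m")
      case True
      obtain k' where k': "k = Suc k'" using \<open>k > 0\<close> by (cases k) auto
      have "i = (m - (k * m - i)) + k' * m" using True that pm k' by simp
      then have "w i \<in> Z \<longleftrightarrow> w (m - (k * m - i)) \<in> Z" using Zperk by metis
      also have "\<dots> \<longleftrightarrow> w (k * m - i) \<in> Z" using that pm by (intro Zrefl) auto
      finally show ?thesis using min[of "k * m - i"] True that by auto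
    next
      case False
      then have "i = (i - k * m) + k * m" by simp
      then have "w i \<in> Z \<longleftrightarrow> w (i - k * m) \<in> Z" using Zperk by metis
      then show ?thesis using min[of "i - k * m"] False that by auto
    qed
    have pZ: "w (k * m + p) \<in> Z" for k
      using Zperk[of p k] p by (simp add: add.commute)
    have nx: "w (k * m + p) \<noteq> x" for k
    proof -
      have "\<not> m dvd k * m + p" using p pm by (auto dest: dvd_imp_le)
      then show ?thesis using x dvd_mult_right by metis
    qed
    define C where "C k = (2 * k + 1) * m" for k
    have C: "C k - p = 2 * m * k + (m - p)" "C k + p = 2 * m * k + (m + p)" for k
      using pm by (simp_all add: C_def algebra_simps)
    have sym: "w (C k - p) = w (C k + p)" for k
      using refl[of "m - p" k] pm unfolding C by simp
    have uZ: "w (C k + p) \<in> Z" "w (C k + p) \<noteq> x" for k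
      using pZ nx unfolding C_def by blast+
    have around: "w i \<noteq> u" if "u \<in> Z" "u \<noteq> x" "2 * m - p < i" "i < 2 * m + p" for u i
      using near[of 2 i] x[of "2 * m"] that by (cases "i = 2 * m") auto
    \<comment> \<open>\<open>C k\<close> is the centre of a return. If its letter recurred at
      distance p, it would have to occur in the positions 2m - p + 1 to 2m + 1, where x is the only
      letter of Z.\<close>
    have ne: "w (C k + p) \<noteq> w (C k)" for k
    proof
      assume eq: "w (C k + p) = w (C k)"
      then have "p \<noteq> 1" using noloop[of "C k"] by auto
      obtain l where l: "l \<le> p" "w (2 * m - p + 1 + l) = w (C k)"
        using bal_window[OF B, of "C k" "w (C k)" p "2 * m - p + 1"] eq p by auto
      have "2 * m - p < 2 * m - p + 1 + l" "2 * m - p + 1 + l < 2 * m + p"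
        using l(1) p pm \<open>p \<noteq> 1\<close> by linarith+
      then show False
        using around[of "w (C k)" "2 * m - p + 1 + l"] uZ[of k] eq l(2) by simp
    qed
    have gap: "cgap w (w (C k + p)) (C k - p) (2 * p)" for k
      unfolding cgap_def
    proof (intro conjI allI impI)
      have Cp: "C k - p + 2 * p = C k + p" using C[of k] pm by simp
      then show "w (C k - p + 2 * p) = w (C k + p)" by argo
      fix l assume l: "0 < l \<and> l < 2 * p"
      show "w (C k - p + l) \<noteq> w (C k + p)"
      proof (cases "C k - p + l = C k")
        case False
        moreover have "C k - p < C k - p + l" "C k - p + l < C k + p"
          using l Cp by linarith+
        ultimately have "w (C k - p + l) \<notin> Z"
          using near[of "2 * k + 1" "C k - p + l", folded C_def] by simp
        then show ?thesis using uZ(1)[of k] by metis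
      qed (use ne[of k] in auto)
    qed (use p sym in auto)
    \<comment> \<open>As u lies in Z and differs from x, it is itself the letter of some centre
      \<open>C k\<close>. The letter v at distance p from that centre is then different from u, and
      both have a gap 2p.\<close>
    define u where "u = w (C 0 + p)"
    obtain q where q: "u = w (m * q)" using uZ(1)[of 0] by (auto simp: u_def Z_def)
    have "odd q"
    proof
      assume "even q"
      then have "2 * m dvd m * q" by auto
      then show False using x[of "m * q"] q uZ(2)[of 0] by (simp add: u_def)
    qed
    then obtain k where k: "q = 2 * k + 1" by (metis oddE)
    define v where "v = w (C k + p)"
    have "v \<noteq> u" using ne[of k] q k by (simp add: v_def C_def mult.commute)
    have uv: "u \<in> Z" "u \<noteq> x" "v \<in> Z" "v \<noteq> x" using uZ by (simp_all add: u_def v_def)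
    have gu: "cgap w u (C 0 - p) (2 * p)" and gv: "cgap w v (C k - p) (2 * p)"
      using gap by (simp_all add: u_def v_def)
    \<comment> \<open>The gap 2p forces u and v into the window of radius p around 2m, where only
      the two ends are free. The occurrence 2m of x is used because 0 has no left
      neighbourhood.\<close>
    have win: "w (2 * m - p) = a \<or> w (2 * m + p) = a"
      if ga: "cgap w a i (2 * p)" and a: "a \<in> Z" "a \<noteq> x" for a i
    proof -
      obtain l where l: "l \<le> 2 * p" "w (2 * m - p + l) = a"
        using bal_window[OF B, of i a "2 * p" "2 * m - p"] ga by (auto simp: cgap_def)
      have "l = 0 \<or> l = 2 * p"
      proof (rule ccontr)
        assume "\<not> ?thesis"
        then have "2 * m - p < 2 * m - p + l" "2 * m - p + l < 2 * m + p"
          using l(1) pm by linarith+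
        then show False using around[OF a] l(2) by blast
      qed
      moreover have "2 * m - p + 2 * p = 2 * m + p" using pm by simp
      ultimately show ?thesis using l(2) by (metis add_0_right)
    qed
    have px: "p < 2 * m" using pm by simp
    have "w (2 * m - p) = u \<and> w (2 * m + p) = v \<or> w (2 * m - p) = v \<and> w (2 * m + p) = u"
      using win[OF gu uv(1,2)] win[OF gv uv(3,4)] \<open>v \<noteq> u\<close> by auto
    then show False
    proof
      assume *: "w (2 * m - p) = u \<and> w (2 * m + p) = v"
      have "alternate w u v \<and> cgap w u (2 * m - p) (Suc (2 * p)) \<and> cgap w v (2 * m - p - 1) (Suc (2 * p))"
        by (rule alternate_around[OF B \<open>v \<noteq> u\<close>[symmetric] gu gv px]) (use * around uv in auto)
      then show False
        using noalt[OF \<open>v \<noteq> u\<close>[symmetric] _ gu _ gv] by blast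
    next
      assume *: "w (2 * m - p) = v \<and> w (2 * m + p) = u"
      have "alternate w v u \<and> cgap w v (2 * m - p) (Suc (2 * p)) \<and> cgap w u (2 * m - p - 1) (Suc (2 * p))"
        by (rule alternate_around[OF B \<open>v \<noteq> u\<close> gv gu px]) (use * around uv in auto)
      then show False
        using noalt[OF \<open>v \<noteq> u\<close> _ gv _ gu] by blast
    qed
  qed
  have Zdvd: "w i \<in> Z \<longleftrightarrow> m dvd i" for i
  proof -
    have "w i \<in> Z \<longleftrightarrow> w (i mod m) \<in> Z"
      using Zperk[of "i mod m" "i div m"] by simp
    also have "\<dots> \<longleftrightarrow> i mod m = 0"
      using empty[of "i mod m"] inZ[of 0] \<open>m > 0\<close> by (cases "i mod m = 0") auto
    finally show ?thesis by (simp add: dvd_eq_mod_eq_0)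
  qed
  show ?thesis
  proof (cases "c \<in> Z")
    case False
    show ?thesis
    proof (rule halving_residue_classes[OF B R noloop \<open>m > 0\<close> Zdvd per _ c False])
      fix i assume i: "0 < i" "i < m"
      have "w i = w (2 * m - i)" using refl[of i 0] i by simp
      moreover have "2 * m - i = m - i + m" using i by simp
      ultimately show "w i = w (m - i)" using per[of "w i" "m - i"] empty[OF i] by simp
    qed
  next
    case True
    show ?thesis
    proof (cases "c = x")
      case True
      then have "\<forall>i. w i = c \<longleftrightarrow> i mod (2 * m) = 0" using x by (simp add: dvd_eq_mod_eq_0)
      moreover have "0 < 2 * m" using \<open>m > 0\<close> by simp
      ultimately show ?thesis by blast
    next
      case False
      \<comment> \<open>A centre letter sits only on odd multiples of m, so its gaps are even; even
        gaps that differ by at most 1 are equal.\<close>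
      have pos: "i mod (2 * m) = m" if "w i = c" for i
      proof -
        have "m dvd i" "\<not> 2 * m dvd i" using Zdvd[of i] x[of i] that True False by auto
        then show ?thesis using mod_double_eq_iff[OF \<open>m > 0\<close>, of i] by simp
      qed
      have gdvd: "2 * m dvd g" if "cgap w c i g" for i g
      proof -
        have "i mod (2 * m) = (i + g) mod (2 * m)"
          using pos[of i] pos[of "i + g"] that by (simp add: cgap_def)
        then show ?thesis by (metis mod_eq_dvd_iff_nat le_add1 add_diff_cancel_left')
      qed
      obtain q where q: "w q = c" using c by auto
      obtain q' where "q' \<ge> Suc q" "w q' = c" using recur_letter[OF R, of "Suc q" q] q by auto
      then obtain g where g: "cgap w c q g" using ex_cgap[of w q c q'] q by auto
      have "h = g" if "cgap w c i h" for i h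
      proof -
        have "even g" "even h" using gdvd[OF g] gdvd[OF that] dvd_mult_left by blast+
        then show ?thesis
          using cgap_le_Suc[OF B g that] cgap_le_Suc[OF B that g] by presburger
      qed
      moreover have "g > 0" using g by (simp add: cgap_def)
      ultimately have "w i = c \<longleftrightarrow> i mod g = q mod g" for i
        using residue_class_if_constant_gap[OF B R q] by blast
      moreover have "q mod g < g" using \<open>g > 0\<close> by simp
      ultimately show ?thesis using \<open>g > 0\<close> by blast
    qed
  qed
qed

section \<open>Exact covering systems\<close>

text \<open>The word itself encodes the covering system: since w is a function into A, its residue
  classes are disjoint and exhaust all positions.\<close>

definition covers :: "(nat \<Rightarrow> 'a) \<Rightarrow> 'a set \<Rightarrow> ('a \<Rightarrow> nat) \<Rightarrow> ('a \<Rightarrow> nat) \<Rightarrow> bool" where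
  "covers w A d r \<longleftrightarrow> finite A \<and> range w \<subseteq> A \<and>
     (\<forall>c\<in>A. r c < d c \<and> (\<forall>i. w i = c \<longleftrightarrow> i mod d c = r c))"

lemma cis_root_power_eq_1_iff:
  assumes "D > 0"
  shows "cis (2 * pi / real D) ^ k = 1 \<longleftrightarrow> D dvd k"
proof -
  let ?w = "cis (2 * pi / real D)"
  have pw: "?w ^ j = cis (2 * pi * real j / real D)" for j
    by (simp add: Complex.DeMoivre algebra_simps)
  have D1: "?w ^ D = 1" using assms by (simp add: pw)
  have "?w ^ k = ?w ^ (D * (k div D) + k mod D)" by simp
  also have "\<dots> = ?w ^ (k mod D)" by (simp only: power_add power_mult D1) simp
  finally have red: "?w ^ k = ?w ^ (k mod D)" .
  have inj: "inj_on (\<lambda>j. cis (2 * pi * real j / real D)) {..<D}"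
    using bij_betw_roots_unity[OF assms] by (simp add: bij_betw_def)
  have "?w ^ (k mod D) = 1 \<longleftrightarrow> k mod D = 0"
    using inj_onD[OF inj, of "k mod D" 0] assms pw[of "k mod D"] by auto
  then show ?thesis using red by (simp add: dvd_eq_mod_eq_0)
qed

lemma sum_residue_class:
  fixes z :: complex
  assumes "z ^ L = 1" "d dvd L" "d > 0" "r < d"
  shows "(\<Sum>n | n < L \<and> n mod d = r. z ^ n) = (if z ^ d = 1 then of_nat (L div d) * z ^ r else 0)"
proof -
  obtain q where q: "L = d * q" using assms(2) by blast
  have "(\<Sum>n | n < L \<and> n mod d = r. z ^ n) = (\<Sum>k<q. z ^ (r + d * k))"
  proof (rule sum.reindex_bij_witness[of _ "\<lambda>k. r + d * k" "\<lambda>n. n div d"])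
    fix k assume "k \<in> {..<q}"
    then have "Suc k * d \<le> L" unfolding q by (metis Suc_leI lessThan_iff mult.commute mult_le_mono2)
    then show "r + d * k \<in> {n. n < L \<and> n mod d = r}"
      using assms(4) by (simp add: mult.commute)
  qed (use assms q in \<open>auto simp: less_mult_imp_div_less mult.commute\<close>)
  also have "\<dots> = z ^ r * (\<Sum>k<q. (z ^ d) ^ k)"
    by (simp add: power_add power_mult sum_distrib_left)
  also have "\<dots> = (if z ^ d = 1 then of_nat (L div d) * z ^ r else 0)"
  proof (cases "z ^ d = 1")
    case True
    then show ?thesis using q assms by simp
  next
    case False
    have "(z ^ d) ^ q = 1" using assms(1) q by (simp add: power_mult)
    then show ?thesis using False by (simp add: geometric_sum)
  qed
  finally show ?thesis .
qed

text \<open>The Mirsky-Newman argument over one common period L instead of with power series. The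
  powers of a primitive D-th root z sum to 0 over L; split by letters, a class with a modulus d < D
  contributes 0 because its ratio z^d is not 1, and the others contribute L/D times a power of
  z.\<close>

lemma covers_sum_max:
  assumes cov: "covers w A d r" and D: "D \<ge> 2" "\<And>c. c \<in> A \<Longrightarrow> d c \<le> D"
  shows "(\<Sum>c | c \<in> A \<and> d c = D. cis (2 * pi / real D) ^ r c) = 0"
proof (cases "\<exists>c\<in>A. d c = D")
  case True
  let ?z = "cis (2 * pi / real D)"
  have fin: "finite A" and cl: "\<And>c. c \<in> A \<Longrightarrow> r c < d c \<and> (\<forall>i. w i = c \<longleftrightarrow> i mod d c = r c)"
    using cov by (auto simp: covers_def)
  define L where "L = (\<Prod>c\<in>A. d c)"
  have dL: "d c dvd L" if "c \<in> A" for c unfolding L_def using fin that by (rule dvd_prodI)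
  have "L > 0" unfolding L_def using cl by (intro prod_pos) fastforce
  have DL: "D dvd L" using True dL by auto
  have one: "?z ^ k = 1 \<longleftrightarrow> D dvd k" for k using cis_root_power_eq_1_iff D by simp
  have zL: "?z ^ L = 1" using one DL by simp
  have "?z \<noteq> 1" using one[of 1] D by simp
  then have "(\<Sum>n<L. ?z ^ n) = 0" using zL by (simp add: geometric_sum)
  also have "(\<Sum>n<L. ?z ^ n) = (\<Sum>c\<in>A. \<Sum>n | n \<in> {..<L} \<and> w n = c. ?z ^ n)"
    by (rule sum.group[symmetric]) (use fin cov in \<open>auto simp: covers_def\<close>)
  also have "\<dots> = (\<Sum>c\<in>A. if d c = D then of_nat (L div D) * ?z ^ r c else 0)"
  proof (rule sum.cong[OF HOL.refl])
    fix c assume c: "c \<in> A"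
    have "{n. n \<in> {..<L} \<and> w n = c} = {n. n < L \<and> n mod d c = r c}" using cl[OF c] by auto
    moreover have "?z ^ d c = 1 \<longleftrightarrow> d c = D"
      using one[of "d c"] D(2)[OF c] cl[OF c] by (auto dest: dvd_imp_le)
    ultimately show "(\<Sum>n | n \<in> {..<L} \<and> w n = c. ?z ^ n) = (if d c = D then of_nat (L div D) * ?z ^ r c else 0)"
      using sum_residue_class[OF zL dL[OF c], of "r c"] cl[OF c] by auto
  qed
  also have "\<dots> = of_nat (L div D) * (\<Sum>c | c \<in> A \<and> d c = D. ?z ^ r c)"
    using fin by (simp add: sum_distrib_left sum.If_cases Int_def)
  finally have "of_nat (L div D) * (\<Sum>c | c \<in> A \<and> d c = D. ?z ^ r c) = 0" by simp
  moreover have "L div D \<noteq> 0" using DL \<open>L > 0\<close> by (metis dvd_div_eq_0_iff neq0_conv)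
  ultimately show ?thesis by simp
next
  case False
  then have "{c \<in> A. d c = D} = {}" by auto
  then show ?thesis by (metis (no_types, lifting) sum.empty)
qed

lemma covers_max_twice:
  assumes cov: "covers w A d r" and "a \<in> A" "d a \<ge> 2" and max: "\<And>c. c \<in> A \<Longrightarrow> d c \<le> d a"
  shows "\<exists>b\<in>A. b \<noteq> a \<and> d b = d a"
proof (rule ccontr)
  assume "\<not> ?thesis"
  then have "{c. c \<in> A \<and> d c = d a} = {a}" using assms(2) by auto
  then show False using covers_sum_max[OF cov assms(3) max] by simp
qed

text \<open>Two roots of unity cancel only if they are opposite, so the residues differ by half the
  modulus.\<close>

lemma covers_max_pair:
  assumes cov: "covers w A d r" and ab: "a \<in> A" "b \<in> A" "a \<noteq> b" "d a = d b" "d a \<ge> 2"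
    and max: "\<And>c. c \<in> A \<Longrightarrow> d c \<le> d a"
    and only: "\<And>c. c \<in> A \<Longrightarrow> d c = d a \<Longrightarrow> c = a \<or> c = b"
  shows "\<exists>h. d a = 2 * h \<and> (r a = r b + h \<or> r b = r a + h)"
proof -
  let ?z = "cis (2 * pi / real (d a))"
  have "{c. c \<in> A \<and> d c = d a} = {a, b}" using ab only by auto
  then have s0: "?z ^ r a + ?z ^ r b = 0"
    using covers_sum_max[OF cov ab(5) max] ab(3) by simp
  have cl: "r a < d a" "r b < d a" using cov ab by (auto simp: covers_def)
  have ne: "r a \<noteq> r b"
  proof
    assume "r a = r b"
    then have "w (r a) = a" "w (r a) = b" using cov ab cl by (auto simp: covers_def)
    then show False using ab by simp
  qed
  have key: "\<exists>h. d a = 2 * h \<and> y = x + h"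
    if "?z ^ x + ?z ^ y = 0" "x < y" "y < d a" for x y
  proof -
    have "?z ^ (2 * (y - x)) = 1"
    proof -
      have "?z ^ y = ?z ^ x * ?z ^ (y - x)" using that(2) by (simp flip: power_add)
      moreover have "?z ^ x \<noteq> 0" by simp
      ultimately have "?z ^ (y - x) = - 1" using that(1)
        by (metis add.inverse_inverse add_eq_0_iff2 mult_cancel_left mult_minus_right mult.right_neutral)
      then show ?thesis by (simp add: power_mult power2_eq_square mult.commute[of 2])
    qed
    then have "d a dvd 2 * (y - x)" using cis_root_power_eq_1_iff[of "d a"] ab(5) by simp
    then obtain q where q: "2 * (y - x) = d a * q" by blast
    have "q = 1"
    proof (cases "q \<ge> 2")
      case True
      then have "d a * 2 \<le> d a * q" by simp
      then show ?thesis using q that by linarith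
    next
      case False
      moreover have "q \<noteq> 0" using q that by (intro notI) simp
      ultimately show ?thesis by simp
    qed
    then show ?thesis using q that by (intro exI[of _ "y - x"]) simp
  qed
  show ?thesis
  proof (cases "r a < r b")
    case True
    then show ?thesis using key[of "r a" "r b"] s0 cl by blast
  next
    case False
    then show ?thesis using key[of "r b" "r a"] s0 cl ne by (metis add.commute linorder_neqE_nat)
  qed
qed

text \<open>The 2-adic valuation as a relation; 0 has no level, so no default value is
  needed.\<close>

definition lv :: "nat \<Rightarrow> nat \<Rightarrow> bool" where
  "lv k v \<longleftrightarrow> 2 ^ k dvd v \<and> \<not> 2 ^ Suc k dvd v"

lemma lv_add_dvd:
  assumes "2 ^ n dvd x" "k < n"
  shows "lv k (v + x) \<longleftrightarrow> lv k v"
proof -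
  have "2 ^ k dvd x" "2 ^ Suc k dvd x"
    using assms by (meson dvd_trans le_imp_power_dvd less_imp_le Suc_leI)+
  then show ?thesis unfolding lv_def by (simp only: dvd_add_left_iff)
qed

lemma lv_unique: "lv k v \<Longrightarrow> lv l v \<Longrightarrow> k = l"
  unfolding lv_def by (metis Suc_leI le_imp_power_dvd linorder_neqE_nat dvd_trans)

lemma ex_lv:
  assumes "v > 0"
  shows "\<exists>k. lv k v"
proof -
  have "\<exists>k. \<not> 2 ^ k dvd v"
    using assms less_exp[of v] dvd_imp_le[of "2 ^ v" v] by (intro exI[of _ v]) linarith
  define m where "m = (LEAST k. \<not> 2 ^ k dvd v)"
  have "\<not> 2 ^ m dvd v" unfolding m_def using \<open>\<exists>k. _\<close> by (rule LeastI_ex)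
  moreover from this obtain k where k: "m = Suc k" by (cases m) auto
  moreover have "2 ^ k dvd v" using not_less_Least[of k "\<lambda>k. \<not> 2 ^ k dvd v"] k m_def by auto
  ultimately show ?thesis by (auto simp: lv_def)
qed

lemma lv_double: "lv (Suc k) (2 * j) \<longleftrightarrow> lv k j"
  by (simp add: lv_def)

text \<open>The two letters of maximal gap interleave, so merging them halves this gap and leaves a
  covering of the same kind with one letter less.\<close>

lemma covers_ruler:
  assumes "covers w A d r" "a \<in> A"
    and "\<And>b c. b \<in> A \<Longrightarrow> c \<in> A \<Longrightarrow> b \<noteq> c \<Longrightarrow> d b = d c \<Longrightarrow> b = a \<or> c = a"
    and "card A = Suc n"
  shows "d a = 2 ^ n \<and> (\<exists>z C. inj_on C {..n} \<and> C n = a \<and>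
    (\<forall>i k. k < n \<longrightarrow> lv k i \<longrightarrow> w (z + i) = C k) \<and> (\<forall>i. 2 ^ n dvd i \<longrightarrow> w (z + i) = a))"
  using assms
proof (induction n arbitrary: w A d r a)
  case 0
  then have "A = {a}" by (metis card_1_singletonE One_nat_def singletonD)
  then have all: "w i = a" for i using 0(1) by (auto simp: covers_def)
  have c: "r a < d a" "\<And>i. i mod d a = r a" using 0 all by (auto simp: covers_def)
  have "d a = 1"
  proof (rule ccontr)
    assume "d a \<noteq> 1"
    then have "1 < d a" using c(1) by linarith
    then show False using c(2)[of 0] c(2)[of 1] by simp
  qed
  then show ?case using all by (intro conjI exI[of _ 0] exI[of _ "\<lambda>_. a"]) auto
next
  case (Suc n)
  note cov = Suc.prems(1) and aA = Suc.prems(2) and co = Suc.prems(3)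
  have fin: "finite A" and cl: "\<And>c. c \<in> A \<Longrightarrow> r c < d c \<and> (\<forall>i. w i = c \<longleftrightarrow> i mod d c = r c)"
    using cov by (auto simp: covers_def)
  have "Max (d ` A) \<in> d ` A" using fin aA by (intro Max_in) auto
  then obtain m where m: "m \<in> A" "d m = Max (d ` A)" by auto
  have mx: "d c \<le> d m" if "c \<in> A" for c using m fin that by auto
  have "d m \<ge> 2"
  proof (rule ccontr)
    assume "\<not> d m \<ge> 2"
    then have d1: "d c = 1 \<and> r c = 0" if "c \<in> A" for c
      using mx[OF that] cl[OF that] by linarith
    then have "w 0 = c" if "c \<in> A" for c using cl[OF that] that by auto
    then have "A = {w 0}" using aA by blast
    then have "card A = 1" by (metis card_1_singleton_iff One_nat_def)
    then show False using Suc.prems(4) by simp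
  qed
  then obtain b0 where "b0 \<in> A" "b0 \<noteq> m" "d b0 = d m"
    using covers_max_twice[OF cov m(1) _ mx] by blast
  \<comment> \<open>The maximal gap is attained twice and every coincidence involves
    \<open>a\<close>; so \<open>a\<close> has the maximal gap, shared with b alone.\<close>
  then obtain b where b: "b \<in> A" "b \<noteq> a" "d b = d a" and mxa: "d a = d m"
    using co[of b0 m] m by metis
  have only: "c = a \<or> c = b" if "c \<in> A" "d c = d a" for c
    using co[of b c] b that by metis
  obtain h where h: "d a = 2 * h" "r a = r b + h \<or> r b = r a + h"
    using covers_max_pair[OF cov aA b(1) b(2)[symmetric] b(3)[symmetric] _ _ only] mx mxa \<open>d m \<ge> 2\<close> by metis
  have "h > 0" using h(1) mxa \<open>d m \<ge> 2\<close> by simp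
  \<comment> \<open>The merged class keeps the name b, which inherits the role of \<open>a\<close>:
    only its new gap h may coincide with another one.\<close>
  define w' where "w' i = (if w i = a then b else w i)" for i
  define d' where "d' = d(b := h)"
  define r' where "r' = r(b := min (r a) (r b))"
  have mrg: "i mod h = min (r a) (r b) \<longleftrightarrow> w i = a \<or> w i = b" for i
  proof -
    have ab: "w i = a \<longleftrightarrow> i mod (2 * h) = r a" "w i = b \<longleftrightarrow> i mod (2 * h) = r b"
      using cl[OF aA] cl[OF b(1)] h(1) b(3) by auto
    have lt: "r a < 2 * h" "r b < 2 * h" using cl[OF aA] cl[OF b(1)] h(1) b(3) by auto
    have m2: "i mod h = (i mod (2 * h)) mod h" by (simp add: mod_mod_cancel)
    have "i mod (2 * h) < 2 * h" using \<open>h > 0\<close> by simp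
    then have "i mod h = i mod (2 * h) \<or> i mod h + h = i mod (2 * h)"
      unfolding m2 by (cases "i mod (2 * h) < h") (auto simp: le_mod_geq)
    moreover have "i mod h < h" using \<open>h > 0\<close> by simp
    ultimately show ?thesis using h(2) lt ab by linarith
  qed
  have cov': "covers w' (A - {a}) d' r'"
    unfolding covers_def
  proof (intro conjI ballI allI)
    show "range w' \<subseteq> A - {a}" using cov b by (auto simp: covers_def w'_def)
    fix c assume c: "c \<in> A - {a}"
    have "min (r a) (r b) < h" using cl[OF aA] cl[OF b(1)] h b(3) by linarith
    then show "r' c < d' c" using c cl[of c] by (simp add: r'_def d'_def)
    fix i show "w' i = c \<longleftrightarrow> i mod d' c = r' c"
    proof (cases "c = b")
      case True
      then show ?thesis using mrg[of i] by (simp add: r'_def d'_def w'_def)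
    next
      case False
      then have "w' i = c \<longleftrightarrow> w i = c" using c by (auto simp: w'_def)
      then show ?thesis using False c cl[of c] by (simp add: r'_def d'_def)
    qed
  qed (use fin in simp)
  have co': "x = b \<or> y = b" if "x \<in> A - {a}" "y \<in> A - {a}" "x \<noteq> y" "d' x = d' y" for x y
    using co[of x y] that by (auto simp: d'_def split: if_splits)
  have "card (A - {a}) = Suc n" using Suc.prems(4) fin aA by simp
  moreover have "b \<in> A - {a}" using b by simp
  ultimately have IH: "d' b = 2 ^ n \<and> (\<exists>z C. inj_on C {..n} \<and> C n = b \<and>
    (\<forall>i k. k < n \<longrightarrow> lv k i \<longrightarrow> w' (z + i) = C k) \<and> (\<forall>i. 2 ^ n dvd i \<longrightarrow> w' (z + i) = b))"
    using Suc.IH[OF cov' _ co'] by blast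
  then have d'b: "d' b = 2 ^ n" by (rule conjunct1)
  from IH obtain z C where "inj_on C {..n} \<and> C n = b \<and>
    (\<forall>i k. k < n \<longrightarrow> lv k i \<longrightarrow> w' (z + i) = C k) \<and> (\<forall>i. 2 ^ n dvd i \<longrightarrow> w' (z + i) = b)" by blast
  then have C: "inj_on C {..n}" "C n = b" "\<And>i k. k < n \<Longrightarrow> lv k i \<Longrightarrow> w' (z + i) = C k"
    "\<And>i. 2 ^ n dvd i \<Longrightarrow> w' (z + i) = b" by blast+
  have hn: "h = 2 ^ n" using d'b by (simp add: d'_def)
  have da: "d a = 2 ^ Suc n" using h(1) hn by simp
  \<comment> \<open>Undoing the merge leaves b at level n and gives \<open>a\<close> the multiples
    of 2^(n + 1).\<close>
  define C' where "C' = C(Suc n := a)"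
  have Ca: "C k \<noteq> a" if "k \<le> n" for k
  proof (cases "k = n")
    case False
    then have "k < n" using that by simp
    moreover have "lv k (2 ^ k)" by (simp add: lv_def)
    ultimately have "w' (z + 2 ^ k) = C k" using C(3) by blast
    then show ?thesis using b(2) by (metis w'_def)
  qed (use C b in simp)
  have "inj_on C' {..Suc n}"
    unfolding inj_on_def
  proof (intro ballI impI)
    fix k l assume "k \<in> {..Suc n}" "l \<in> {..Suc n}" and eq: "C' k = C' l"
    then consider "k \<le> n" "l \<le> n" | "k \<le> n" "l = Suc n" | "k = Suc n" "l \<le> n" | "k = l"
      by (auto simp: le_Suc_eq)
    then show "k = l"
    proof cases
      case 1
      then have "C k = C l" using eq by (simp add: C'_def)
      then show ?thesis using 1 C(1) by (auto simp: inj_on_def)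
    next
      case 2
      then show ?thesis using eq Ca[of k] by (simp add: C'_def)
    next
      case 3
      then show ?thesis using eq Ca[of l] by (simp add: C'_def)
    qed
  qed
  have low: "w (z + i) = C' k" if "k < n" "lv k i" for i k
  proof -
    have "w' (z + i) = C k" using C(3) that by blast
    moreover have "C k \<noteq> b" using C(1,2) that unfolding inj_on_def by force
    ultimately show ?thesis using that Ca[of k] by (auto simp: w'_def C'_def split: if_splits)
  qed
  have perw: "w (i + x) = c \<longleftrightarrow> w i = c" if "c = a \<or> c = b" "2 ^ Suc n dvd x" for c i x
  proof -
    have "d c = 2 ^ Suc n" "c \<in> A" using that aA b da by auto
    moreover have "(i + x) mod 2 ^ Suc n = i mod 2 ^ Suc n" using that(2) by (metis add.right_neutral dvd_imp_mod_0 mod_add_right_eq)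
    ultimately show ?thesis using cl by metis
  qed
  have perab: "\<not> (w i = c \<and> w (i + 2 ^ n) = c)" if "c = a \<or> c = b" for c i
  proof
    assume *: "w i = c \<and> w (i + 2 ^ n) = c"
    have "d c = 2 ^ Suc n" "c \<in> A" using that aA b da by auto
    then have "i mod 2 ^ Suc n = (i + 2 ^ n) mod 2 ^ Suc n" using * cl by metis
    then have "2 ^ Suc n dvd (i + 2 ^ n) - i" using mod_eq_dvd_iff_nat[of i "i + 2 ^ n" "2 ^ Suc n"] by simp
    then show False by (auto dest: dvd_imp_le)
  qed
  have hi: "w (z + i) = a \<or> w (z + i) = b" if "2 ^ n dvd i" for i
    using C(4)[OF that] by (auto simp: w'_def split: if_splits)
  \<comment> \<open>On the multiples of 2^n the letters a and b alternate, so \<open>a\<close> is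
    found at offset 0 or 2^n. Moving the origin there does not affect levels below n.\<close>
  obtain y where y: "2 ^ n dvd y" "w (z + y) = a"
    using hi[of 0] hi[of "2 ^ n"] perab[of b z] by (metis add_0_right dvd_0_right dvd_refl)
  have "w (z + y + i) = C' k" if k: "k < Suc n" "lv k i" for i k
  proof (cases "k = n")
    case False
    then have "k < n" using k by simp
    then have "lv k (i + y)" using lv_add_dvd[OF y(1)] k by simp
    then show ?thesis using low[OF \<open>k < n\<close>, of "i + y"] by (simp add: add_ac)
  next
    case True
    have "2 ^ n dvd i" "\<not> 2 ^ Suc n dvd i" using k True by (auto simp: lv_def)
    then obtain q where q: "i = 2 ^ n * q" "odd q" by (auto simp: mult.commute)
    then obtain q' where q': "q = 2 * q' + 1" by (metis oddE)
    have i: "i = 2 ^ n + 2 ^ Suc n * q'" using q q' by (simp add: algebra_simps)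
    have "w (z + y + 2 ^ n) \<noteq> a" using perab[of a "z + y"] y by simp
    then have "w (z + y + 2 ^ n) = b" using hi[of "y + 2 ^ n"] y by (simp add: add.assoc)
    then have "w (z + y + 2 ^ n + 2 ^ Suc n * q') = b" using perw[of b] by simp
    then show ?thesis using True i C(2) by (simp add: C'_def add.assoc)
  qed
  moreover have "w (z + y + i) = a" if "2 ^ Suc n dvd i" for i
    using perw[of a i "z + y"] that y by simp
  moreover have "C' (Suc n) = a" by (simp add: C'_def)
  ultimately show ?case
    using da \<open>inj_on C' {..Suc n}\<close> by blast
qed

section \<open>Factors, frequencies and episturmian words\<close>

lemma window_in_factors: "map s [i..<i + n] \<in> factors s"
  by (auto simp: factors_def occurs_at_def)

lemma factorsE:
  assumes "u \<in> factors s"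
  obtains i where "u = map s [i..<i + length u]"
  using assms by (auto simp: factors_def occurs_at_def dest: sym)

lemma window_eq_iff:
  "map s [i..<i + n] = map t [j..<j + n] \<longleftrightarrow> (\<forall>k<n. s (i + k) = t (j + k))"
  by (auto simp: list_eq_iff_nth_eq)

lemma count_list_window: "int (count_list (map s [i..<i + n]) c) = cnt s c i n"
  by (induction n) (auto simp: cnt_Suc)

lemma balanced_imp_bal:
  assumes "balanced s"
  shows "bal s"
  unfolding bal_def
proof (intro allI)
  fix c i j n
  have "\<bar>int (count_list (map s [i..<i + n]) c) - int (count_list (map s [j..<j + n]) c)\<bar> \<le> 1"
    using assms window_in_factors unfolding balanced_def by (metis length_map length_upt add_diff_cancel_left')
  then show "cnt s c i n \<le> cnt s c j n + 1"
    by (simp only: count_list_window)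
qed

lemma recurrent_imp_recur:
  assumes "recurrent s"
  shows "recur s"
  unfolding recur_def
proof (intro allI)
  fix i n N
  have "infinite {j. occurs_at (map s [i..<i + n]) s j}"
    using assms window_in_factors[of s i n] unfolding recurrent_def by blast
  then obtain j where j: "j \<ge> N" "occurs_at (map s [i..<i + n]) s j"
    unfolding infinite_nat_iff_unbounded_le by blast
  then have "map s [j..<j + n] = map s [i..<i + n]" by (simp add: occurs_at_def)
  then show "\<exists>j\<ge>N. \<forall>k<n. s (j + k) = s (i + k)"
    using j(1) window_eq_iff by blast
qed

lemma factors_shift:
  assumes "recur s"
  shows "factors (\<lambda>i. s (q + i)) = factors s"
proof
  show "factors (\<lambda>i. s (q + i)) \<subseteq> factors s"
  proof
    fix u assume "u \<in> factors (\<lambda>i. s (q + i))"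
    then obtain i where i: "u = map (\<lambda>i. s (q + i)) [i..<i + length u]" by (rule factorsE)
    also have "\<dots> = map s [q + i..<q + i + length u]" by (rule nth_equalityI) (simp_all add: add.assoc)
    finally show "u \<in> factors s" using window_in_factors by metis
  qed
  show "factors s \<subseteq> factors (\<lambda>i. s (q + i))"
  proof
    fix u assume "u \<in> factors s"
    then obtain i where i: "u = map s [i..<i + length u]" by (rule factorsE)
    obtain j where j: "j \<ge> q" "\<forall>k<length u. s (j + k) = s (i + k)" using recurD[OF assms] by blast
    have "u = map (\<lambda>i. s (q + i)) [j - q..<j - q + length u]"
      by (subst i, rule nth_equalityI) (use j in auto)
    then show "u \<in> factors (\<lambda>i. s (q + i))" using window_in_factors by metis
  qed
qed

lemma episturmian_cong: "factors s = factors t \<Longrightarrow> episturmian s \<longleftrightarrow> episturmian t"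
  unfolding episturmian_def right_special_def by simp

text \<open>By balance the count over k n letters is k times the count over n letters, up to k.
  Comparing the averages at n and at k with the one at k n yields a Cauchy sequence.\<close>

lemma bal_has_frequency:
  assumes "bal s"
  shows "\<exists>f. has_frequency s c f"
proof -
  let ?x = "\<lambda>n. real_of_int (cnt s c 0 n) / real n"
  have mult: "\<bar>cnt s c 0 (k * n) - int k * cnt s c 0 n\<bar> \<le> int k" for k n
  proof (induction k)
    case (Suc k)
    have "cnt s c 0 (Suc k * n) = cnt s c 0 (k * n) + cnt s c (k * n) n"
      using cnt_add[of s c 0 "k * n" n] by (simp add: add.commute)
    moreover have "\<bar>cnt s c (k * n) n - cnt s c 0 n\<bar> \<le> 1"
      using balD[OF assms, of c "k * n" n 0] balD[OF assms, of c 0 n "k * n"] by linarith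
    moreover have "int (Suc k) * cnt s c 0 n = int k * cnt s c 0 n + cnt s c 0 n"
      by (simp add: algebra_simps)
    ultimately show ?case using Suc by simp
  qed simp
  have near: "\<bar>?x (k * n) - ?x n\<bar> \<le> 1 / real n" if "k > 0" "n > 0" for k n
  proof -
    let ?y = "real_of_int (cnt s c 0 (k * n) - int k * cnt s c 0 n)"
    have "?x (k * n) - ?x n = ?y / (real k * real n)"
      using that by (simp add: field_simps)
    then have "\<bar>?x (k * n) - ?x n\<bar> = \<bar>?y\<bar> / (real k * real n)"
      by (simp add: abs_divide)
    also have "\<bar>?y\<bar> \<le> real k"
      using mult[of k n] by linarith
    then have "\<bar>?y\<bar> / (real k * real n) \<le> real k / (real k * real n)"
      by (intro divide_right_mono) auto
    finally show ?thesis using that by simp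
  qed
  have near2: "\<bar>?x k - ?x n\<bar> \<le> 1 / real n + 1 / real k" if "k > 0" "n > 0" for k n
    using near[OF that] near[OF that(2,1)] by (simp add: mult.commute)
  have "Cauchy ?x"
  proof (rule metric_CauchyI)
    fix e :: real assume e: "0 < e"
    obtain M :: nat where M: "2 / e < real M" using reals_Archimedean2 by blast
    have "M > 0" using M e by (cases M) (auto simp: divide_less_0_iff)
    show "\<exists>M. \<forall>m\<ge>M. \<forall>n\<ge>M. dist (?x m) (?x n) < e"
    proof (intro exI[of _ M] allI impI)
      fix m n assume mn: "m \<ge> M" "n \<ge> M"
      have lt: "1 / real k < e / 2" if "k \<ge> M" for k
      proof -
        have "2 / e < real k" using M that by linarith
        moreover have "real k > 0" using that \<open>M > 0\<close> by simp
        ultimately show ?thesis using e by (simp add: field_simps)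
      qed
      show "dist (?x m) (?x n) < e"
        using near2[of m n] lt[of m] lt[of n] mn \<open>M > 0\<close> unfolding dist_real_def by linarith
    qed
  qed
  then obtain f where "?x \<longlonglongrightarrow> f" using Cauchy_convergent convergent_def by blast
  moreover have "real (count_list (map s [0..<n]) c) = real_of_int (cnt s c 0 n)" for n
    using count_list_window[of s 0 n c] by (metis add_0 of_int_of_nat_eq)
  ultimately show ?thesis unfolding has_frequency_def by auto
qed

text \<open>Both limits exist by balance, so a subsequence of prefix lengths is enough to compare
  them.\<close>

lemma equal_frequency_if_bounded:
  fixes e :: "nat \<Rightarrow> nat"
  assumes "bal s" "strict_mono e" and bd: "\<And>j. \<bar>cnt s b 0 (e j) - cnt s c 0 (e j)\<bar> \<le> K"
  shows "\<exists>f. has_frequency s b f \<and> has_frequency s c f"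
proof -
  obtain f g where fg: "has_frequency s b f" "has_frequency s c g"
    using bal_has_frequency[OF assms(1)] by metis
  have cl: "real (count_list (map s [0..<n]) x) = real_of_int (cnt s x 0 n)" for n x
    using count_list_window[of s 0 n x] by (metis add_0 of_int_of_nat_eq)
  have lim: "(\<lambda>j. real_of_int (cnt s x 0 (e j)) / real (e j)) \<longlonglongrightarrow> h" if "has_frequency s x h" for x h
    using LIMSEQ_subseq_LIMSEQ[OF that[unfolded has_frequency_def cl] assms(2)] by (simp add: o_def)
  have "(\<lambda>j. real_of_int (cnt s b 0 (e j)) / real (e j) - real_of_int (cnt s c 0 (e j)) / real (e j)) \<longlonglongrightarrow> f - g"
    by (intro tendsto_diff lim fg)
  moreover have "(\<lambda>j. real_of_int (cnt s b 0 (e j)) / real (e j) - real_of_int (cnt s c 0 (e j)) / real (e j)) \<longlonglongrightarrow> 0"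
  proof (rule tendsto_0_le[where K = 1])
    have "(\<lambda>n. real_of_int K / real n) \<longlonglongrightarrow> 0" by (rule lim_const_over_n)
    from LIMSEQ_subseq_LIMSEQ[OF this assms(2)]
    show "(\<lambda>j. real_of_int K / real (e j)) \<longlonglongrightarrow> 0" by (simp add: o_def)
    show "\<forall>\<^sub>F j in sequentially. norm (real_of_int (cnt s b 0 (e j)) / real (e j) - real_of_int (cnt s c 0 (e j)) / real (e j))
      \<le> norm (real_of_int K / real (e j)) * 1"
    proof (rule always_eventually, rule allI)
      fix j
      let ?y = "real_of_int (cnt s b 0 (e j) - cnt s c 0 (e j))"
      have "\<bar>?y\<bar> \<le> \<bar>real_of_int K\<bar>" using bd[of j] by linarith
      then have "\<bar>?y\<bar> / real (e j) \<le> \<bar>real_of_int K\<bar> / real (e j)" by (intro divide_right_mono) auto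
      moreover have "real_of_int (cnt s b 0 (e j)) / real (e j) - real_of_int (cnt s c 0 (e j)) / real (e j) = ?y / real (e j)"
        by (simp add: diff_divide_distrib)
      ultimately show "norm (real_of_int (cnt s b 0 (e j)) / real (e j) - real_of_int (cnt s c 0 (e j)) / real (e j))
      \<le> norm (real_of_int K / real (e j)) * 1"
        by (simp only: real_norm_def abs_divide abs_of_nat mult_1_right)
    qed
  qed
  ultimately have "f - g = 0" by (rule LIMSEQ_unique)
  then show ?thesis using fg by auto
qed

section \<open>Ruler words: reversal and right special factors\<close>

lemma lv_diff:
  assumes "2 ^ m dvd x" "k < m" "l \<le> x"
  shows "lv k (x - l) \<longleftrightarrow> lv k l"
proof -
  have *: "2 ^ j dvd x - l \<longleftrightarrow> 2 ^ j dvd l" if "j \<le> m" for j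
  proof -
    have "2 ^ j dvd x" using assms(1) that by (meson dvd_trans le_imp_power_dvd)
    then show ?thesis using assms(3) by (metis dvd_add_right_iff dvd_add_left_iff le_add_diff_inverse2)
  qed
  show ?thesis unfolding lv_def using *[of k] *[of "Suc k"] assms(2) by simp
qed

lemma lv_less:
  assumes "lv k v" "0 < v" "v < 2 ^ n"
  shows "k < n"
proof (rule ccontr)
  assume "\<not> k < n"
  then have "(2::nat) ^ n \<le> 2 ^ k" by (simp add: power_increasing)
  moreover have "2 ^ k \<le> v" using assms unfolding lv_def by (auto dest: dvd_imp_le)
  ultimately show False using assms(3) by linarith
qed

text \<open>For n = 3 the period reads \<open>L 0, L 1, L 0, L 2, L 0, L 1, L 0\<close>. Indices
  within a period start at 1 and stay below 2^n, so each has a level below n.\<close>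

locale ruler_word =
  fixes s :: "nat \<Rightarrow> 'a" and n N :: nat and L :: "nat \<Rightarrow> 'a"
  assumes n: "n \<ge> 1" and N: "Suc N = 2 ^ n" and inj: "inj_on L {..<n}"
    and ruler: "lv k (Suc (i mod N)) \<Longrightarrow> s i = L k"
begin

lemma N_pos: "N > 0"
proof -
  have "(2::nat) ^ 1 \<le> 2 ^ n" using n by (intro power_increasing) auto
  then show ?thesis using N by simp
qed

lemma lv_N: "lv 0 N"
proof -
  have "even (Suc N)" unfolding N using n by simp
  then show ?thesis by (simp add: lv_def)
qed

lemma idx_le: "Suc (i mod N) \<le> N"
  using N_pos by (simp add: Suc_le_eq)

lemma ex_level: "\<exists>k<n. lv k (Suc (i mod N)) \<and> s i = L k"
proof -
  obtain k where "lv k (Suc (i mod N))" using ex_lv by blast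
  moreover have "Suc (i mod N) < 2 ^ n" using idx_le[of i] N by linarith
  ultimately show ?thesis using lv_less ruler by blast
qed

text \<open>The indices of i and j within the period add up to 2^n, and v and 2^n - v have the same
  level.\<close>

lemma mirror:
  assumes "Suc (i + j) = N * q"
  shows "s i = s j"
proof -
  have "(i mod N + j mod N + 1) mod N = 0"
  proof -
    have "(i mod N + j mod N + 1) mod N = (i + j + 1) mod N" by (metis mod_add_eq mod_add_left_eq)
    then show ?thesis using assms by simp
  qed
  then obtain t where t: "i mod N + j mod N + 1 = N * t" by (auto simp: mod_eq_0_iff_dvd)
  have "i mod N < N" "j mod N < N" using N_pos by simp_all
  then have "N * t < N * 2" "0 < N * t" using t by linarith+
  then have "t = 1" by auto
  then have sum: "Suc (i mod N) = 2 ^ n - Suc (j mod N)" using t N by simp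
  obtain k where k: "k < n" "lv k (Suc (j mod N))" "s j = L k" using ex_level by blast
  then have "lv k (Suc (i mod N))"
    unfolding sum using idx_le[of j] N by (subst lv_diff[of n]) auto
  then show ?thesis using k ruler by simp
qed

lemma idx_back:
  assumes "l < Suc (i mod N)"
  shows "Suc ((i - l) mod N) = Suc (i mod N) - l"
proof -
  have "i = N * (i div N) + i mod N" by simp
  then have "i - l = N * (i div N) + (i mod N - l)" using assms by linarith
  then have "(i - l) mod N = (i mod N - l) mod N" by (metis mod_mult_self4)
  also have "\<dots> = i mod N - l" using N_pos by (simp add: less_imp_diff_less)
  finally show ?thesis using assms by simp
qed

lemma idx_wrap:
  assumes "l = Suc (i mod N)" "l \<le> i"
  shows "Suc ((i - l) mod N) = N"
proof -
  have i: "i = N * (i div N) + i mod N" by simp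
  then have "i div N \<noteq> 0" using assms by (metis mult_0_right add_0 not_less_eq_eq order_refl)
  then obtain q where q: "i div N = Suc q" by (cases "i div N") auto
  have "i - l = N * q + (N - 1)" using i assms q N_pos by simp
  then have "(i - l) mod N = (N - 1) mod N" by (metis mod_mult_self4)
  then show ?thesis using N_pos by simp
qed

text \<open>Going back by 2^m turns an odd multiple of 2^m into an even one. From index 2^m itself
  it wraps around to the odd index N of level 0; this is a change unless m = 0, whence the last
  hypothesis.\<close>

lemma level_changes:
  assumes m: "lv m (Suc (i mod N))" and "2 ^ m \<le> i" and "m \<ge> 1 \<or> 2 ^ m < Suc (i mod N)"
  shows "\<exists>k<n. k \<noteq> m \<and> s (i - 2 ^ m) = L k"
proof (cases "2 ^ m < Suc (i mod N)")
  case True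
  obtain k where k: "k < n" "lv k (Suc ((i - 2 ^ m) mod N))" "s (i - 2 ^ m) = L k"
    using ex_level by blast
  have k': "lv k (Suc (i mod N) - 2 ^ m)" using k idx_back[OF True] by simp
  have "\<not> lv m (Suc (i mod N) - 2 ^ m)"
  proof -
    obtain q where q: "Suc (i mod N) = 2 ^ m * q" using m by (auto simp: lv_def)
    then have "odd q" using m unfolding lv_def q by auto
    moreover have "Suc (i mod N) - 2 ^ m = 2 ^ m * (q - 1)" using q by (simp add: diff_mult_distrib2)
    ultimately show ?thesis by (auto simp: lv_def)
  qed
  then show ?thesis using k k' by blast
next
  case False
  then have "Suc (i mod N) = 2 ^ m" using m by (auto simp: lv_def dest: dvd_imp_le)
  then have "Suc ((i - 2 ^ m) mod N) = N" using idx_wrap[of "2 ^ m" i] assms(2) by simp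
  then have "s (i - 2 ^ m) = L 0" using ruler lv_N by metis
  then show ?thesis using assms(3) False n by (intro exI[of _ 0]) auto
qed

text \<open>The index of j is a multiple of 2^b, so up to distance 2^b the levels before j are those
  of the distances. Agreement cannot reach that far: at distance 2^a the word has level a before j,
  but not before i.\<close>

lemma special_core:
  assumes "lv a (Suc (i mod N))" "lv b (Suc (j mod N))" "a < b"
    and "len \<le> i" "len \<le> j" and eq: "\<And>l. 1 \<le> l \<Longrightarrow> l \<le> len \<Longrightarrow> s (i - l) = s (j - l)"
  shows "1 \<le> l \<Longrightarrow> l \<le> len \<Longrightarrow> lv k l \<Longrightarrow> s (j - l) = L k"
proof -
  have bn: "b < n"
    using lv_less[OF assms(2)] idx_le[of j] N by simp
  have bj: "2 ^ b \<le> Suc (j mod N)" using assms(2) by (auto simp: lv_def dest: dvd_imp_le)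
  have lvj: "s (j - l) = L k" if "1 \<le> l" "l < 2 ^ b" "lv k l" for l k
  proof (rule ruler)
    have kb: "k < b" using lv_less[OF that(3)] that by simp
    have lt: "l < Suc (j mod N)" using that(2) bj by linarith
    have "lv k (Suc (j mod N) - l)"
      using lv_diff[of b "Suc (j mod N)" k l] assms(2) kb that(3) lt by (auto simp: lv_def)
    then show "lv k (Suc ((j - l) mod N))" using idx_back[OF lt] by simp
  qed
  have inj': "x = y" if "L x = L y" "x < n" "y < n" for x y using inj that by (auto simp: inj_on_def)
  have "len < 2 ^ b"
  proof (rule ccontr)
    assume "\<not> len < 2 ^ b"
    then have len: "2 ^ b \<le> len" by simp
    have ab: "(2::nat) ^ a < 2 ^ b" using assms(3) by simp
    show False
    proof (cases "a \<ge> 1 \<or> 2 ^ a < Suc (i mod N)")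
      case True
      then obtain k where k: "k < n" "k \<noteq> a" "s (i - 2 ^ a) = L k"
        using level_changes[OF assms(1)] len ab assms(4) by auto
      have "s (j - 2 ^ a) = L a" by (rule lvj) (use ab in \<open>auto simp: lv_def\<close>)
      then have "L k = L a" using eq[of "2 ^ a"] len ab k by simp
      then show False using inj' k assms(3) bn by simp
    next
      \<comment> \<open>Here i starts a period and the step by 2^0 wraps around to level 0 again.
        The distance 2^b separates instead: before i it leads to index 2^n - 2^b of level b, before
        j the level b is lost.\<close>
      case False
      then have "a = 0" by simp
      then have a0: "a = 0" "i mod N = 0" using False by simp_all
      have b1: "b \<ge> 1" using assms(3) by simp
      obtain k where k: "k < n" "k \<noteq> b" "s (j - 2 ^ b) = L k"
        using level_changes[OF assms(2)] len assms(5) b1 by auto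
      have "s (i - 2 ^ b) = L b"
      proof (rule ruler)
        obtain q where q: "i = N * q" using a0 by auto
        have bN: "(2::nat) ^ b \<le> N" using bn N by (metis Suc_leI less_Suc_eq_le power_strict_increasing_iff one_less_numeral_iff semiring_norm(76))
        have "0 < i" using len assms(4) by (metis le_trans less_le_trans zero_less_numeral zero_less_power)
        then obtain q' where "q = Suc q'" using q by (cases q) auto
        then have "i - 2 ^ b = N * q' + (N - 2 ^ b)" using q bN by simp
        then have "(i - 2 ^ b) mod N = N - 2 ^ b" using N_pos by simp
        then have "Suc ((i - 2 ^ b) mod N) = 2 ^ n - 2 ^ b" using N bN by simp
        then show "lv b (Suc ((i - 2 ^ b) mod N))"
          using lv_diff[of n "2 ^ n" b "2 ^ b"] bn by (simp add: lv_def)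
      qed
      then have "L k = L b" using eq[of "2 ^ b"] len k by simp
      then show False using inj' k bn by simp
    qed
  qed
  then show "1 \<le> l \<Longrightarrow> l \<le> len \<Longrightarrow> lv k l \<Longrightarrow> s (j - l) = L k" using lvj by simp
qed

lemma special_suffix:
  assumes "s i \<noteq> s j" "len \<le> i" "len \<le> j"
    and eq: "\<And>l. 1 \<le> l \<Longrightarrow> l \<le> len \<Longrightarrow> s (i - l) = s (j - l)"
    and "1 \<le> l" "l \<le> len" "lv k l"
  shows "s (i - l) = L k"
proof -
  obtain a b where ab: "lv a (Suc (i mod N))" "s i = L a" "lv b (Suc (j mod N))" "s j = L b"
    using ex_level by metis
  then have "a \<noteq> b" using assms(1) by auto
  then consider "a < b" | "b < a" by linarith
  then show ?thesis
  proof cases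
    case 1
    then show ?thesis using special_core[OF ab(1,3) 1 assms(2,3) eq] assms(5-7) eq by simp
  next
    case 2
    show ?thesis
      by (rule special_core[OF ab(3,1) 2 assms(3,2) eq[symmetric] assms(5-7)])
  qed
qed

text \<open>Read from its end, a right special factor follows the ruler sequence, so its length
  determines it.\<close>

lemma right_special_nth:
  assumes "right_special s u" "1 \<le> l" "l \<le> length u" "lv k l"
  shows "u ! (length u - l) = L k"
proof -
  obtain x y where xy: "x \<noteq> y" "u @ [x] \<in> factors s" "u @ [y] \<in> factors s"
    using assms(1) by (auto simp: right_special_def)
  have occ: "\<exists>i. (\<forall>m<length u. u ! m = s (i + m)) \<and> z = s (i + length u)" if "u @ [z] \<in> factors s" for z
  proof -
    obtain i where i: "u @ [z] = map s [i..<i + length (u @ [z])]" using \<open>u @ [z] \<in> factors s\<close> by (rule factorsE)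
    have "(u @ [z]) ! m = s (i + m)" if "m < Suc (length u)" for m
    proof -
      have "(u @ [z]) ! m = map s [i..<i + length (u @ [z])] ! m" using i by simp
      also have "\<dots> = s (i + m)" using that by (simp del: upt_Suc)
      finally show ?thesis .
    qed
    note nth = this
    have "u ! m = s (i + m)" if "m < length u" for m using nth[of m] that by (simp add: nth_append)
    moreover have "z = s (i + length u)" using nth[of "length u"] by simp
    ultimately show ?thesis by blast
  qed
  obtain i where i: "\<forall>m<length u. u ! m = s (i + m)" "x = s (i + length u)" using occ[OF xy(2)] by blast
  obtain j where j: "\<forall>m<length u. u ! m = s (j + m)" "y = s (j + length u)" using occ[OF xy(3)] by blast
  have si: "s (i + length u - l) = u ! (length u - l)" if "1 \<le> l" "l \<le> length u" for l
    using i(1)[rule_format, of "length u - l"] that by simp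
  have sj: "s (j + length u - l) = u ! (length u - l)" if "1 \<le> l" "l \<le> length u" for l
    using j(1)[rule_format, of "length u - l"] that by simp
  have "s (i + length u - l) = L k"
    by (rule special_suffix[of _ "j + length u" "length u"]) (use assms i j xy si sj in auto)
  then show ?thesis using si assms by simp
qed

lemma episturmian_ruler: "episturmian s"
  unfolding episturmian_def
proof (intro conjI ballI allI impI)
  fix u assume "u \<in> factors s"
  then obtain i where i: "u = map s [i..<i + length u]" by (rule factorsE)
  define l where "l = length u"
  \<comment> \<open>With j + i + l a multiple of N, \<open>mirror\<close> maps the window at i onto
    the one at j.\<close>
  define j where "j = N * (i + l) - (i + l)"
  have "i + l \<le> N * (i + l)" using N_pos by simp
  then have j: "j + (i + l) = N * (i + l)" by (simp add: j_def)
  have "rev u = map s [j..<j + l]"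
  proof (rule nth_equalityI)
    fix k assume k: "k < length (rev u)"
    then have kl: "k < l" by (simp add: l_def)
    have "rev u ! k = u ! (l - Suc k)" using k by (simp add: rev_nth l_def)
    also have "\<dots> = s (i + (l - Suc k))" by (subst i) (use kl in \<open>simp add: l_def\<close>)
    also have "\<dots> = s (j + k)" by (rule mirror[of _ _ "i + l"]) (use j kl in simp)
    finally show "rev u ! k = map s [j..<j + l] ! k" using kl by simp
  qed (simp add: l_def)
  then show "rev u \<in> factors s" using window_in_factors by metis
next
  fix m u v
  assume uv: "right_special s u \<and> length u = m \<and> right_special s v \<and> length v = m"
  show "u = v"
  proof (rule nth_equalityI)
    fix q assume q: "q < length u"
    obtain k where k: "lv k (length u - q)" using ex_lv[of "length u - q"] q by auto
    have "u ! (length u - (length u - q)) = L k" by (rule right_special_nth) (use uv k q in auto)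
    moreover have "v ! (length v - (length u - q)) = L k" by (rule right_special_nth) (use uv k q in auto)
    ultimately show "u ! q = v ! q" using q uv by simp
  qed (use uv in simp)
qed

end

section \<open>Removing runs of a separating letter\<close>

text \<open>The word \<open>t\<close> arises from \<open>s\<close> (from position \<open>e 0\<close> on) by deleting the \<open>p\<close> letters \<open>a\<close>
  following each letter other than \<open>a\<close>; the position \<open>j\<close> of \<open>t\<close> comes from the position \<open>e j\<close>
  of \<open>s\<close>.\<close>

locale desub =
  fixes s :: "nat \<Rightarrow> 'a" and a :: 'a and p :: nat and e :: "nat \<Rightarrow> nat" and t :: "nat \<Rightarrow> 'a"
  assumes bal_s: "bal s" and recur_s: "recur s"
    and run: "s i \<noteq> a \<Longrightarrow> 1 \<le> q \<Longrightarrow> q \<le> p \<Longrightarrow> s (i + q) = a"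
    and short_run: "\<exists>q\<le>Suc p. s (i + q) \<noteq> a"
    and long_run: "\<exists>i. \<forall>q\<le>p. s (i + q) = a"
    and e_Suc: "e (Suc j) = e j + (if t j = a then 1 else Suc p)"
    and t: "t j = s (e j)"
    and t0: "t 0 \<noteq> a" and p_le_e0: "p \<le> e 0"
    and before0: "1 \<le> q \<Longrightarrow> q \<le> p \<Longrightarrow> s (e 0 - q) = a"
begin

lemma strict_mono_e: "strict_mono e"
  by (simp add: strict_mono_Suc_iff e_Suc)

lemma e_le_iff: "e i \<le> e j \<longleftrightarrow> i \<le> j"
  by (rule strict_mono_less_eq[OF strict_mono_e])

lemma e_less_iff: "e i < e j \<longleftrightarrow> i < j"
  by (rule strict_mono_less[OF strict_mono_e])

lemma p_le_e: "p \<le> e j"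
  using p_le_e0 e_le_iff[of 0 j] by simp

text \<open>This allows windows of s to be extended to the left of \<open>e j\<close>, or trimmed on
  the right before \<open>e j\<close>, by p letters \<open>a\<close>.\<close>

lemma before: "1 \<le> q \<Longrightarrow> q \<le> p \<Longrightarrow> s (e j - q) = a"
proof (induction j arbitrary: q)
  case (Suc j)
  show ?case
  proof (cases "t j = a")
    case True
    then have e: "e (Suc j) = Suc (e j)" by (simp add: e_Suc)
    show ?thesis
    proof (cases "q = 1")
      case True
      then show ?thesis using e \<open>t j = a\<close> t by simp
    next
      case False
      then have "1 \<le> q - 1" "q - 1 \<le> p" using Suc.prems by simp_all
      then have "s (e j - (q - 1)) = a" by (rule Suc.IH)
      moreover have "e (Suc j) - q = e j - (q - 1)" using e Suc.prems by simp
      ultimately show ?thesis by simp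
    qed
  next
    case False
    then have "e (Suc j) - q = e j + (Suc p - q)" using Suc.prems by (simp add: e_Suc)
    then show ?thesis using run[of "e j" "Suc p - q"] False t Suc.prems by simp
  qed
qed (rule before0)

lemma find_block:
  assumes "e 0 \<le> i"
  shows "\<exists>j. e j \<le> i \<and> i < e (Suc j)"
proof -
  define j where "j = (LEAST j. i < e (Suc j))"
  have "i < e (Suc i)"
    using strict_mono_imp_increasing[OF strict_mono_e, of "Suc i"] by simp
  then have j: "i < e (Suc j)" unfolding j_def by (rule LeastI)
  have "e j \<le> i"
  proof (cases j)
    case (Suc k)
    then have "k < j" by simp
    then have "\<not> i < e (Suc k)" unfolding j_def by (rule not_less_Least)
    then show ?thesis using Suc by simp
  qed (use assms in simp)
  then show ?thesis using j by blast
qed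

lemma block_tail:
  assumes "e j < i" "i < e (Suc j)"
  shows "t j \<noteq> a" "s i = a" "i \<le> e j + p"
proof -
  show *: "t j \<noteq> a" using assms by (auto simp: e_Suc split: if_splits)
  then show "i \<le> e j + p" using assms by (simp add: e_Suc)
  then show "s i = a" using run[of "e j" "i - e j"] * t assms by simp
qed

lemma non_a_position:
  assumes "e 0 \<le> i" "s i \<noteq> a"
  shows "\<exists>j. e j = i"
proof -
  obtain j where "e j \<le> i" "i < e (Suc j)" using find_block[OF assms(1)] by blast
  then show ?thesis using block_tail[of j i] assms(2) by (cases "e j = i") auto
qed

text \<open>A letter other than \<open>a\<close> occupies p + 1 positions of s, an \<open>a\<close>
  only one; so equally long windows of t differ in s by p positions per \<open>a\<close>.\<close>

lemma e_add: "int (e (i + n)) = int (e i) + (int p + 1) * int n - int p * cnt t a i n"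
  by (induction n) (auto simp: cnt_Suc e_Suc algebra_simps)

lemma e_split: "e (i + Suc n) - e i = (e (i + n) - e i) + (e (Suc (i + n)) - e (i + n))"
  using e_le_iff[of i "i + n"] e_le_iff[of "i + n" "Suc (i + n)"] by simp

lemma cnt_step:
  assumes "c \<noteq> a \<or> p = 0"
  shows "cnt s c (e j) (e (Suc j) - e j) = of_bool (t j = c)"
proof (cases "t j = a \<or> p = 0")
  case True
  then have "e (Suc j) - e j = Suc 0" by (auto simp: e_Suc)
  then show ?thesis by (simp add: cnt_Suc t)
next
  case False
  then have "cnt s c (e j) (e (Suc j) - e j) = of_bool (s (e j) = c) + cnt s c (Suc (e j)) p"
    by (simp add: e_Suc cnt_Suc_left)
  moreover have "cnt s c (Suc (e j)) p = 0"
  proof (rule cnt_eq_0)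
    fix k assume "k < p"
    then show "s (Suc (e j) + k) \<noteq> c" using run[of "e j" "Suc k"] False assms t by simp
  qed
  ultimately show ?thesis by (simp add: t)
qed

lemma cnt_eq:
  assumes "c \<noteq> a \<or> p = 0"
  shows "cnt s c (e i) (e (i + n) - e i) = cnt t c i n"
proof (induction n)
  case (Suc n)
  have "cnt s c (e i) (e (i + Suc n) - e i) = cnt s c (e i) (e (i + n) - e i)
      + cnt s c (e (i + n)) (e (Suc (i + n)) - e (i + n))"
    unfolding e_split using cnt_add[of s c "e i" "e (i + n) - e i"] e_le_iff[of i "i + n"] by simp
  then show ?case using Suc cnt_step[OF assms] by (simp add: cnt_Suc)
qed simp

lemma cnt_a_eq: "cnt s a (e i) (e (i + n) - e i) = cnt t a i n + int p * (int n - cnt t a i n)"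
proof (induction n)
  case (Suc n)
  have "cnt s a (e i) (e (i + Suc n) - e i) = cnt s a (e i) (e (i + n) - e i)
      + cnt s a (e (i + n)) (e (Suc (i + n)) - e (i + n))"
    unfolding e_split using cnt_add[of s a "e i" "e (i + n) - e i"] e_le_iff[of i "i + n"] by simp
  moreover have "cnt s a (e j) (e (Suc j) - e j) = (if t j = a then 1 else int p)" for j
  proof (cases "t j = a")
    case True
    then show ?thesis by (simp add: e_Suc cnt_Suc t)
  next
    case False
    then have "cnt s a (e j) (e (Suc j) - e j) = cnt s a (Suc (e j)) p"
      using t by (simp add: e_Suc cnt_Suc_left)
    also have "\<dots> = int p"
    proof (rule cnt_all)
      fix k assume "k < p"
      then show "s (Suc (e j) + k) = a" using run[of "e j" "Suc k"] False t by simp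
    qed
    finally show ?thesis using False by simp
  qed
  ultimately show ?case using Suc by (simp add: cnt_Suc algebra_simps)
qed simp

lemma cnt_trim:
  assumes "p \<le> e (i + n) - e i"
  shows "cnt s c (e i) (e (i + n) - e i) = cnt s c (e i) (e (i + n) - e i - p) + (if c = a then int p else 0)"
proof -
  have "e (i + n) - e i = (e (i + n) - e i - p) + p" using assms by simp
  then have "cnt s c (e i) (e (i + n) - e i) = cnt s c (e i) (e (i + n) - e i - p)
      + cnt s c (e i + (e (i + n) - e i - p)) p"
    by (metis cnt_add)
  also have "e i + (e (i + n) - e i - p) = e (i + n) - p"
    using assms e_le_iff[of i "i + n"] by simp
  finally have *: "cnt s c (e i) (e (i + n) - e i) = cnt s c (e i) (e (i + n) - e i - p)
      + cnt s c (e (i + n) - p) p" .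
  have "s (e (i + n) - p + k) = a" if "k < p" for k
    using before[of "p - k" "i + n"] that p_le_e[of "i + n"] by simp
  then have "cnt s c (e (i + n) - p) p = (if c = a then int p else 0)"
    by (cases "c = a") (auto intro: cnt_all cnt_eq_0)
  then show ?thesis using * by simp
qed

lemma len_eq: "int (e (i + n) - e i) = (int p + 1) * int n - int p * cnt t a i n"
  using e_add[of i n] e_le_iff[of i "i + n"] by simp

text \<open>Extending one window by \<open>p\<close> letters \<open>a\<close> and trimming \<open>p\<close> letters \<open>a\<close> from the other one makes
  their lengths equal.\<close>

lemma bal_t_a: "cnt t a i n \<le> cnt t a j n + 1"
proof (rule cnt_le_if_no_diff2)
  fix i j
  show "cnt t a i n \<noteq> cnt t a j n + 2"
  proof
    assume eq: "cnt t a i n = cnt t a j n + 2"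
    let ?S = "e (i + n) - e i" and ?T = "e (j + n) - e j"
    have "int ?T = int ?S + 2 * int p"
      unfolding len_eq eq by (simp add: algebra_simps)
    then have T: "?T = ?S + 2 * p" by linarith
    have "cnt s a (e i - p) (p + ?S) = cnt s a (e i - p) p + cnt s a (e i) ?S"
      using cnt_add[of s a "e i - p" p ?S] p_le_e[of i] by simp
    moreover have "cnt s a (e i - p) p = int p"
    proof (rule cnt_all)
      fix k assume "k < p"
      then show "s (e i - p + k) = a" using before[of "p - k" i] p_le_e[of i] by simp
    qed
    moreover have "cnt s a (e j) ?T = cnt s a (e j) (?T - p) + int p"
      using cnt_trim[of j n a] T by simp
    moreover have "?T - p = p + ?S" using T by simp
    moreover have "cnt s a (e i - p) (p + ?S) \<le> cnt s a (e j) (p + ?S) + 1"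
      by (rule balD[OF bal_s])
    ultimately have "int p + cnt s a (e i) ?S \<le> cnt s a (e j) ?T - int p + 1" by simp
    then show False unfolding cnt_a_eq eq by (simp add: algebra_simps)
  qed
qed

lemma bal_t: "bal t"
  unfolding bal_def
proof (intro allI)
  fix c i j n
  show "cnt t c i n \<le> cnt t c j n + 1"
  proof (cases "c = a")
    case True
    then show ?thesis using bal_t_a by simp
  next
    case False
    let ?S = "e (i + n) - e i" and ?T = "e (j + n) - e j"
    have c: "cnt s c (e i) ?S = cnt t c i n" "cnt s c (e j) ?T = cnt t c j n"
      using cnt_eq False by simp_all
    have "cnt t a j n \<le> cnt t a i n + 1" by (rule bal_t_a)
    then consider "cnt t a j n \<le> cnt t a i n" | "cnt t a j n = cnt t a i n + 1" by linarith
    then show ?thesis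
    proof cases
      case 1
      then have "int p * cnt t a j n \<le> int p * cnt t a i n" by (intro mult_left_mono) auto
      then have "int ?S \<le> int ?T" unfolding len_eq by simp
      then have "?S \<le> ?T" by simp
      then have "cnt s c (e i) ?S \<le> cnt s c (e i) ?T" by (intro cnt_mono) auto
      also have "\<dots> \<le> cnt s c (e j) ?T + 1" by (rule balD[OF bal_s])
      finally show ?thesis using c by simp
    next
      case 2
      then have "int ?S = int ?T + int p" unfolding len_eq by (simp add: algebra_simps)
      then have S: "?S - p = ?T" "p \<le> ?S" by linarith+
      then have "cnt s c (e i) ?S = cnt s c (e i) ?T"
        using cnt_trim[of i n c] False by simp
      also have "\<dots> \<le> cnt s c (e j) ?T + 1" by (rule balD[OF bal_s])
      finally show ?thesis using c by simp
    qed
  qed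
qed

text \<open>The repeated window of s starts with \<open>t 0\<close>, which is not \<open>a\<close>.
  Past \<open>e 0\<close> such a letter always sits at some \<open>e j\<close>, so the copy is
  aligned with t.\<close>

lemma recur_t: "recur t"
  unfolding recur_def
proof (intro allI)
  fix i n N
  obtain J where J: "J \<ge> e N" "\<forall>k<Suc (e (i + n) - e 0). s (J + k) = s (e 0 + k)"
    using recurD[OF recur_s] by blast
  have "e 0 \<le> J" using J(1) e_le_iff[of 0 N] by simp
  moreover have "s J \<noteq> a" using J(2)[rule_format, of 0] t0 t by simp
  ultimately obtain j where j: "e j = J" using non_a_position by blast
  have "N \<le> j" using J(1) j e_le_iff[of N j] by simp
  have same: "e (j + k) + e 0 = J + e k \<and> t (j + k) = t k" if "k \<le> i + n" for k
    using that
  proof (induction k)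
    case 0
    then show ?case using j J(2)[rule_format, of 0] t by simp
  next
    case (Suc k)
    then have IH: "e (j + k) + e 0 = J + e k" "t (j + k) = t k" by simp_all
    have E: "e (j + Suc k) + e 0 = J + e (Suc k)" using IH by (simp add: e_Suc)
    have le: "e 0 \<le> e (Suc k)" "e (Suc k) \<le> e (i + n)" using Suc.prems by (simp_all add: e_le_iff)
    have "s (J + (e (Suc k) - e 0)) = s (e 0 + (e (Suc k) - e 0))"
      by (rule J(2)[rule_format]) (use le in simp)
    moreover have "J + (e (Suc k) - e 0) = e (j + Suc k)" using E le by simp
    moreover have "e 0 + (e (Suc k) - e 0) = e (Suc k)" using le by simp
    ultimately show ?case using E t by metis
  qed
  have "t (j + i + k) = t (i + k)" if "k < n" for k
    using same[of "i + k"] that by (simp add: add.assoc)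
  then show "\<exists>j\<ge>N. \<forall>k<n. t (j + k) = t (i + k)"
    using \<open>N \<le> j\<close> by (intro exI[of _ "j + i"]) auto
qed

text \<open>The first such pair would follow a letter other than \<open>a\<close>; with the p
  deleted letters it would form a run of p + 2 letters \<open>a\<close>.\<close>

lemma no_aa_t: "\<not> (t j = a \<and> t (Suc j) = a)"
proof (induction j)
  case 0
  then show ?case using t0 by simp
next
  case (Suc j)
  show ?case
  proof
    assume *: "t (Suc j) = a \<and> t (Suc (Suc j)) = a"
    then have tj: "t j \<noteq> a" using Suc by blast
    then have E: "e (Suc j) = e j + Suc p" "e (Suc (Suc j)) = e j + Suc (Suc p)"
      using * by (simp_all add: e_Suc)
    obtain q where q: "q \<le> Suc p" "s (Suc (e j) + q) \<noteq> a" using short_run by blast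
    consider "q < p" | "q = p" | "q = Suc p" using q(1) by linarith
    then show False
    proof cases
      case 1
      then show False using run[of "e j" "Suc q"] tj t q(2) by simp
    next
      case 2
      then show False using q(2) * E t[of "Suc j"] by simp
    next
      case 3
      then show False using q(2) * E t[of "Suc (Suc j)"] by simp
    qed
  qed
qed

text \<open>Only \<open>a\<close> could get lost, but a run of p + 1 letters \<open>a\<close> is
  longer than what is deleted, and its last position survives.\<close>

lemma range_t: "range t = range s"
proof
  show "range t \<subseteq> range s" using t by auto
  show "range s \<subseteq> range t"
  proof
    fix c assume "c \<in> range s"
    then obtain i where i: "s i = c" by auto
    show "c \<in> range t"
    proof (cases "c = a")
      case False
      obtain j where j: "j \<ge> e 0" "s j = c" using recur_letter[OF recur_s, of "e 0" i] i by auto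
      then obtain k where "e k = j" using non_a_position False by blast
      then show ?thesis using t j by (metis rangeI)
    next
      case True
      obtain i where i: "\<forall>q\<le>p. s (i + q) = a" using long_run by blast
      obtain j where j: "j \<ge> e 0" "\<forall>k<Suc p. s (j + k) = s (i + k)" using recurD[OF recur_s] by blast
      have ja: "s (j + q) = a" if "q \<le> p" for q using i j(2) that by simp
      obtain k where k: "e k \<le> j + p" "j + p < e (Suc k)"
        using find_block[of "j + p"] j(1) by auto
      have "j + p = e k"
      proof (rule ccontr)
        assume "j + p \<noteq> e k"
        then have "t k \<noteq> a" "j + p \<le> e k + p" using block_tail[of k "j + p"] k by auto
        moreover from this have "s (e k) = a" using ja[of "e k - j"] k by simp
        ultimately show False using t by simp
      qed
      then show ?thesis using ja[of p] t True by (metis order_refl rangeI)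
    qed
  qed
qed

lemma cgap_transfer:
  assumes "b \<noteq> a" "cgap t b i g"
  shows "cgap s b (e i) (e (i + g) - e i)"
  unfolding cgap_def
proof (intro conjI allI impI)
  have g: "0 < g" "t i = b" "t (i + g) = b" "\<And>k. 0 < k \<Longrightarrow> k < g \<Longrightarrow> t (i + k) \<noteq> b"
    using assms(2) by (auto simp: cgap_def)
  have lt: "e i < e (i + g)" using g(1) e_less_iff by simp
  then show "0 < e (i + g) - e i" by simp
  show "s (e i) = b" using g t by simp
  show "s (e i + (e (i + g) - e i)) = b" using g t lt by simp
  fix k assume k: "0 < k \<and> k < e (i + g) - e i"
  show "s (e i + k) \<noteq> b"
  proof
    assume b: "s (e i + k) = b"
    have "e 0 \<le> e i + k" using e_le_iff[of 0 i] by simp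
    then obtain j where j: "e j = e i + k" using non_a_position b assms(1) by blast
    have "e i < e j" "e j < e (i + g)" using j k by linarith+
    then have "i < j" "j < i + g" by (simp_all add: e_less_iff)
    then have "0 < j - i" "j - i < g" "t (i + (j - i)) = b" using b j t by auto
    then show False using g(4) by blast
  qed
qed

text \<open>In s the two gaps differ by (p + 1)(g - h), while balance allows a difference of at most
  1.\<close>

lemma cgap_same:
  assumes "b \<noteq> a" "p \<ge> 1" "cgap t b i g" "cgap t b j h" "cnt t a i g = cnt t a j h"
  shows "g = h"
proof -
  have "cgap s b (e i) (e (i + g) - e i)" "cgap s b (e j) (e (j + h) - e j)"
    using cgap_transfer assms by blast+
  then have "\<bar>int (e (i + g) - e i) - int (e (j + h) - e j)\<bar> \<le> 1"
    using cgap_le_Suc[OF bal_s] by (smt (verit) of_nat_Suc of_nat_le_iff)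
  moreover have "int (e (i + g) - e i) - int (e (j + h) - e j) = (int p + 1) * (int g - int h)"
    unfolding len_eq assms(5) by (simp add: algebra_simps)
  ultimately have "(int p + 1) * \<bar>int g - int h\<bar> \<le> 1" by (simp add: abs_mult)
  moreover have "int p + 1 \<le> (int p + 1) * \<bar>int g - int h\<bar>" if "g \<noteq> h"
    using mult_left_mono[of 1 "\<bar>int g - int h\<bar>" "int p + 1"] that by simp
  ultimately show ?thesis using assms(2) by linarith
qed

text \<open>If bb occurs, every two adjacent positions contain b, so a third letter c appears as
  bcb. Then b has the gaps p + 1 and 2(p + 1) in s.\<close>

lemma noloop_t:
  assumes "c \<in> range s" "c \<noteq> a" "c \<noteq> b" "b \<noteq> a" "p \<ge> 1"
  shows "\<not> (t i = b \<and> t (Suc i) = b)"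
proof
  assume b: "t i = b \<and> t (Suc i) = b"
  have win: "t j = b \<or> t (Suc j) = b" for j
    using bal_window[OF bal_t, of i b 1 j] b by (auto simp: le_Suc_eq)
  obtain j0 where j0: "t j0 = c" using assms(1) range_t by (metis imageE)
  obtain j where j: "j \<ge> 1" "t j = c" using recur_letter[OF recur_t, of 1 j0] j0 by auto
  then obtain k where k: "j = Suc k" by (cases j) auto
  have tk: "t k = b" "t (Suc k) = c" "t (Suc (Suc k)) = b"
    using win[of k] win[of "Suc k"] j k assms by auto
  have g1: "cgap t b i 1" unfolding cgap_def using b by auto
  have g2: "cgap t b k 2" using tk assms by (auto simp: cgap_def less_2_cases_iff numeral_2_eq_2 less_Suc_eq)
  have "e (i + 1) - e i = Suc p" "e (k + 2) - e k = 2 * Suc p"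
    using b tk assms by (auto simp: e_Suc numeral_2_eq_2)
  then show False
    using cgap_le_Suc[OF bal_s cgap_transfer[OF assms(4) g1] cgap_transfer[OF assms(4) g2]] assms(5) by simp
qed

text \<open>Deletion changes only the count of \<open>a\<close>. The prefix lengths
  \<open>e (q + j)\<close> are those at which counts in s can be read off from t.\<close>

lemma equal_frequency_transfer:
  assumes "b \<noteq> a \<or> p = 0" "c \<noteq> a \<or> p = 0" "\<And>n. \<bar>cnt t b q n - cnt t c q n\<bar> \<le> K"
  shows "\<exists>f. has_frequency s b f \<and> has_frequency s c f"
proof (rule equal_frequency_if_bounded[OF bal_s, of "\<lambda>j. e (q + j)"])
  show "strict_mono (\<lambda>j. e (q + j))"
    using strict_mono_e by (simp add: strict_mono_def)
  fix j
  have "cnt s x 0 (e (q + j)) = cnt s x 0 (e q) + cnt t x q j" if "x \<noteq> a \<or> p = 0" for x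
    using cnt_add[of s x 0 "e q" "e (q + j) - e q"] cnt_eq[OF that, of q j] e_le_iff[of q "q + j"] by simp
  then show "\<bar>cnt s b 0 (e (q + j)) - cnt s c 0 (e (q + j))\<bar>
      \<le> \<bar>cnt s b 0 (e q) - cnt s c 0 (e q)\<bar> + K"
    using assms(1,2) assms(3)[of j] by simp
qed

section \<open>Oddities\<close>

lemma occurrences_window:
  assumes "n \<le> m"
  shows "occurrences (map s [j..<j + n]) (map s [i..<i + m])
    = {q. q + n \<le> m \<and> (\<forall>k<n. s (i + q + k) = s (j + k))}"
proof -
  have "take n (drop q (map s [i..<i + m])) = map s [i + q..<i + q + n]" if "q + n \<le> m" for q
    using that by (intro nth_equalityI) (auto simp: add.assoc)
  then show ?thesis
    unfolding occurrences_def by (auto simp: window_eq_iff)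
qed

lemma palindrome_window_iff:
  "palindrome (map s [i..<i + Suc m]) \<longleftrightarrow> (\<forall>k\<le>m. s (i + k) = s (i + (m - k)))"
proof -
  have "palindrome (map s [i..<i + Suc m])
    \<longleftrightarrow> (\<forall>k<Suc m. rev (map s [i..<i + Suc m]) ! k = map s [i..<i + Suc m] ! k)"
    unfolding palindrome_def by (auto simp: list_eq_iff_nth_eq)
  also have "\<dots> \<longleftrightarrow> (\<forall>k<Suc m. s (i + (m - k)) = s (i + k))"
  proof -
    have "rev (map s [i..<i + Suc m]) ! k = s (i + (m - k))" "map s [i..<i + Suc m] ! k = s (i + k)"
      if "k < Suc m" for k
      using that by (simp_all add: rev_nth del: upt_Suc)
    then show ?thesis by auto
  qed
  finally show ?thesis by (auto simp: less_Suc_eq_le)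
qed

lemma oddity_if_return:
  assumes "n > 0" and len: "n \<le> m"
    and pal: "\<And>k. k < n \<Longrightarrow> s (i + k) = s (i + (n - Suc k))"
    and suf: "\<And>k. k < n \<Longrightarrow> s (i + (m - n) + k) = s (i + k)"
    and two: "\<And>q. q + n \<le> m \<Longrightarrow> (\<And>k. k < n \<Longrightarrow> s (i + q + k) = s (i + k)) \<Longrightarrow> q = 0 \<or> q = m - n"
    and "n < m" and np: "\<not> palindrome (map s [i..<i + m])"
  shows "{map s [i..<i + m], rev (map s [i..<i + m])} \<in> oddities s"
proof -
  let ?u = "map s [i..<i + n]" and ?w = "map s [i..<i + m]"
  have "palindrome ?u"
  proof -
    obtain n' where n': "n = Suc n'" using assms(1) by (cases n) auto
    have "\<forall>k\<le>n'. s (i + k) = s (i + (n' - k))" using pal n' by simp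
    then show ?thesis unfolding n' palindrome_window_iff .
  qed
  moreover have "occurrences ?u ?w = {0, m - n}"
    unfolding occurrences_window[OF len] using two suf len by auto
  then have "card (occurrences ?u ?w) = 2" using \<open>n < m\<close> by simp
  moreover have "prefix ?u ?w"
  proof -
    have "?w = ?u @ map s [i + n..<i + m]"
      using upt_add_eq_append[of i "i + n" "m - n"] len by simp
    then show ?thesis by (metis prefixI)
  qed
  moreover have "suffix ?u ?w"
  proof -
    have "?w = map s [i..<i + (m - n)] @ map s [i + (m - n)..<i + m]"
      using upt_add_eq_append[of i "i + (m - n)" n] len by simp
    moreover have "map s [i + (m - n)..<i + m] = ?u"
      by (rule nth_equalityI) (use len suf in auto)
    ultimately show ?thesis by (metis suffixI)
  qed
  moreover have "?w \<in> factors s" "?u \<in> factors s" using window_in_factors by auto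
  moreover have "?u \<noteq> []" using assms(1) by simp
  ultimately have "odd_return s ?w" using np unfolding odd_return_def complete_return_def by blast
  then show ?thesis unfolding oddities_def by blast
qed

definition e' :: "nat \<Rightarrow> nat" where
  "e' k = (if t k = a then e k - p else e k)"

text \<open>Reversal turns the last letter of a run of \<open>a\<close> into the first one, so it exchanges \<open>e\<close> and \<open>e'\<close>.\<close>

lemma e'_Suc: "e' (Suc k) = e' k + (if t (Suc k) = a then 1 else Suc p)"
proof (cases "t k = a")
  case True
  then have "t (Suc k) \<noteq> a" using no_aa_t[of k] by simp
  then show ?thesis using True p_le_e[of k] by (simp add: e'_def e_Suc)
qed (simp add: e'_def e_Suc)

lemma s_e': "s (e' k) = t k"
proof (cases "t k = a \<and> p > 0")
  case True
  then show ?thesis using before[of p k] by (simp add: e'_def)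
qed (auto simp: e'_def t)

text \<open>Walking upwards along \<open>e\<close> and downwards along \<open>e'\<close> takes equal
  steps as long as the letters agree. The two positions therefore stay mirror images in s.\<close>

lemma palindrome_transfer:
  assumes "t j = t (j + g)" and pal: "\<And>q. e j + q \<le> e' (j + g) \<Longrightarrow> s (e j + q) = s (e' (j + g) - q)"
  shows "k \<le> g \<Longrightarrow> e (j + k) + e' (j + g - k) = e j + e' (j + g) \<and> t (j + k) = t (j + g - k)"
proof (induction k)
  case 0
  then show ?case using assms(1) by simp
next
  case (Suc k)
  then have IH: "e (j + k) + e' (j + g - k) = e j + e' (j + g)" "t (j + k) = t (j + g - k)" by simp_all
  have sk: "j + g - k = Suc (j + g - Suc k)" using Suc.prems by simp
  have E: "e (j + Suc k) + e' (j + g - Suc k) = e j + e' (j + g)"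
    using IH e'_Suc[of "j + g - Suc k"] e_Suc[of "j + k"] unfolding sk by simp
  have le: "e j \<le> e (j + Suc k)" "e (j + Suc k) \<le> e j + e' (j + g)"
    using E by (simp_all add: e_le_iff)
  have mono: "e' i \<le> e' (i + d)" for i d
  proof (induction d)
    case (Suc d)
    then show ?case using e'_Suc[of "i + d"] by simp
  qed simp
  have ej: "e j \<le> e' (Suc j)"
    using no_aa_t[of j] by (cases "t j = a") (auto simp: e'_def e_Suc)
  show ?case
  proof (cases "e (j + Suc k) \<le> e' (j + g)")
    case True
    have "s (e j + (e (j + Suc k) - e j)) = s (e' (j + g) - (e (j + Suc k) - e j))"
      by (rule pal) (use True le in simp)
    moreover have "e j + (e (j + Suc k) - e j) = e (j + Suc k)" using le by simp
    moreover have "e' (j + g) - (e (j + Suc k) - e j) = e' (j + g - Suc k)" using E le by simp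
    ultimately show ?thesis using E t s_e' by metis
  next
    case False
    \<comment> \<open>The walk passes \<open>e' (j + g)\<close> at its last step only, where the end
      letters agree by assumption.\<close>
    have "Suc k = g"
    proof (rule ccontr)
      assume "Suc k \<noteq> g"
      then have "j + g - Suc k = Suc j + (g - Suc (Suc k))" using Suc.prems by simp
      then have "e j \<le> e' (j + g - Suc k)" using mono[of "Suc j" "g - Suc (Suc k)"] ej by simp
      then show False using E False by simp
    qed
    then show ?thesis using E assms(1) by simp
  qed
qed

text \<open>For x other than \<open>a\<close> the return in s is to the letter x. A single
  \<open>a\<close> would already return inside its run, so for x = a the palindrome is the run of p
  + 1 letters \<open>a\<close>, which ends exactly at the letters \<open>a\<close> of t.\<close>

lemma oddity_word:
  assumes gap: "cgap t x j g" and k: "k \<le> g" "t (j + k) \<noteq> t (j + g - k)"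
  shows "\<exists>W. W \<noteq> [] \<and> hd W = x \<and> last W = x \<and> {W, rev W} \<in> oddities s"
proof -
  have g: "0 < g" "t j = x" "t (j + g) = x" "\<And>k. 0 < k \<Longrightarrow> k < g \<Longrightarrow> t (j + k) \<noteq> x"
    using gap by (auto simp: cgap_def)
  have lt: "e j < e (j + g)" using g(1) e_less_iff by simp
  have nopal: "\<not> (\<forall>q. e j + q \<le> e' (j + g) \<longrightarrow> s (e j + q) = s (e' (j + g) - q))"
    using palindrome_transfer[of j g k] g k by auto
  have ends: "map s [i..<i + Suc m] \<noteq> [] \<and> hd (map s [i..<i + Suc m]) = s i \<and> last (map s [i..<i + Suc m]) = s (i + m)"
    for i m by (simp add: hd_map last_map del: upt_Suc)
  show ?thesis
  proof (cases "x = a")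
    case False
    let ?m = "e (j + g) - e j"
    have "{map s [e j..<e j + Suc ?m], rev (map s [e j..<e j + Suc ?m])} \<in> oddities s"
    proof (rule oddity_if_return[of 1])
      show "s (e j + (Suc ?m - 1) + k) = s (e j + k)" if "k < 1" for k
        using that lt t[of j] t[of "j + g"] g by simp
      show "q = 0 \<or> q = Suc ?m - 1"
        if q: "q + 1 \<le> Suc ?m" "\<And>k. k < 1 \<Longrightarrow> s (e j + q + k) = s (e j + k)" for q
      proof -
        have "s (e j + q) = x" using q(2)[of 0] g t by simp
        then show ?thesis using cgap_transfer[OF False gap] q(1) unfolding cgap_def by fastforce
      qed
      show "\<not> palindrome (map s [e j..<e j + Suc ?m])"
      proof
        assume "palindrome (map s [e j..<e j + Suc ?m])"
        then have pal: "s (e j + q) = s (e j + (?m - q))" if "q \<le> ?m" for q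
          using that unfolding palindrome_window_iff by blast
        have "e' (j + g) = e (j + g)" using g False by (simp add: e'_def)
        then have "s (e j + q) = s (e' (j + g) - q)" if "e j + q \<le> e' (j + g)" for q
          using pal[of q] that by simp
        then show False using nopal by blast
      qed
    qed (use lt in auto)
    moreover have "s (e j) = x" "s (e j + ?m) = x" using g t lt by simp_all
    ultimately show ?thesis using ends[of "e j" ?m] by metis
  next
    case True
    let ?i = "e j - p" and ?m = "e (j + g) - e j + p"
    have runa: "s (e l - p + r) = a" if "t l = a" "r \<le> p" for l r
    proof (cases "r = p")
      case True
      then show ?thesis using that t[of l] p_le_e[of l] by simp
    next
      case False
      then show ?thesis using before[of "p - r" l] that p_le_e[of l] by simp
    qed
    have ta: "t j = a" "t (j + g) = a" using g True by simp_all
    have im: "?i + (Suc ?m - Suc p) = e (j + g) - p" "?i + ?m = e (j + g)"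
      using lt p_le_e[of j] by simp_all
    have "{map s [?i..<?i + Suc ?m], rev (map s [?i..<?i + Suc ?m])} \<in> oddities s"
    proof (rule oddity_if_return[of "Suc p"])
      show "s (?i + k) = s (?i + (Suc p - Suc k))" if "k < Suc p" for k
        using runa[OF ta(1), of k] runa[OF ta(1), of "Suc p - Suc k"] that by simp
      show "s (?i + (Suc ?m - Suc p) + k) = s (?i + k)" if "k < Suc p" for k
        unfolding im using runa[OF ta(1), of k] runa[OF ta(2), of k] that by simp
      show "q = 0 \<or> q = Suc ?m - Suc p"
        if q: "q + Suc p \<le> Suc ?m" "\<And>k. k < Suc p \<Longrightarrow> s (?i + q + k) = s (?i + k)" for q
      proof (rule ccontr)
        assume "\<not> ?thesis"
        \<comment> \<open>The occurrence at offset q ends at \<open>e j + q\<close>. Strictly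
          between the two ends, its p + 1 positions include some \<open>e l\<close> with
          \<open>t l\<close> different from \<open>a\<close>.\<close>
        then have q': "e j < e j + q" "e j + q < e (j + g)" using q(1) by auto
        have sa: "s (?i + q + r) = a" if "r \<le> p" for r
          using q(2)[of r] runa[OF ta(1), of r] that by simp
        obtain l where l: "e l \<le> e j + q" "e j + q < e (Suc l)"
          using find_block[of "e j + q"] e_le_iff[of 0 j] by auto
        show False
        proof (cases "e l = e j + q")
          case True
          then have "j < l" "l < j + g" using q' e_less_iff by metis+
          then have "t l \<noteq> a" using g(4)[of "l - j"] \<open>x = a\<close> by simp
          then show False using sa[of p] True t[of l] p_le_e[of j] by simp
        next
          case False
          then have tl: "t l \<noteq> a" "e j + q \<le> e l + p" using block_tail[of l "e j + q"] l by auto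
          have "s (?i + q + (e l + p - (e j + q))) = a" by (rule sa) (use l in linarith)
          moreover have "?i + q + (e l + p - (e j + q)) = e l" using tl p_le_e[of j] by linarith
          ultimately show False using tl t by simp
        qed
      qed
      show "\<not> palindrome (map s [?i..<?i + Suc ?m])"
      proof
        assume "palindrome (map s [?i..<?i + Suc ?m])"
        then have pal: "s (?i + q) = s (?i + (?m - q))" if "q \<le> ?m" for q
          using that unfolding palindrome_window_iff by blast
        have e': "e' (j + g) = e (j + g) - p" using ta by (simp add: e'_def)
        have "s (e j + q) = s (e' (j + g) - q)" if q: "e j + q \<le> e' (j + g)" for q
        proof -
          have "p + q \<le> ?m" using q e' by linarith
          then have "s (?i + (p + q)) = s (?i + (?m - (p + q)))" by (rule pal)
          moreover have "?i + (p + q) = e j + q" using p_le_e[of j] by simp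
          moreover have "?i + (?m - (p + q)) = e' (j + g) - q" using p_le_e[of j] q e' by linarith
          ultimately show ?thesis by simp
        qed
        then show False using nopal by blast
      qed
    qed (use lt in auto)
    moreover have "s ?i = x" "s (?i + ?m) = x"
      using runa[OF ta(1), of 0] im(2) ta(2) t[of "j + g"] True by simp_all
    ultimately show ?thesis using ends[of ?i ?m] by metis
  qed
qed

text \<open>Pigeonhole: both \<open>W x\<close> and its reversal begin with x, so different letters
  yield different unordered pairs.\<close>

lemma ex_palindromic_letter:
  assumes "finite (range s)" "finite (oddities s)" "card (oddities s) < card (range s)"
  shows "\<exists>x\<in>range s. \<forall>j g k. cgap t x j g \<longrightarrow> k \<le> g \<longrightarrow> t (j + k) = t (j + g - k)"
proof (rule ccontr)
  assume "\<not> ?thesis"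
  then have "\<forall>x\<in>range s. \<exists>W. W \<noteq> [] \<and> hd W = x \<and> last W = x \<and> {W, rev W} \<in> oddities s"
    using oddity_word by blast
  then obtain W where W: "\<forall>x\<in>range s. W x \<noteq> [] \<and> hd (W x) = x \<and> last (W x) = x \<and> {W x, rev (W x)} \<in> oddities s"
    by (rule bchoice[THEN exE])
  have "inj_on (\<lambda>x. {W x, rev (W x)}) (range s)"
  proof (rule inj_onI)
    fix x y assume xy: "x \<in> range s" "y \<in> range s" "{W x, rev (W x)} = {W y, rev (W y)}"
    then have "W x = W y \<or> W x = rev (W y)" by blast
    moreover have "hd (W x) = x" "hd (W y) = y" "hd (rev (W y)) = y" using W xy by (auto simp: hd_rev)
    ultimately show "x = y" by metis
  qed
  then have "card (range s) \<le> card (oddities s)"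
    by (rule card_inj_on_le) (use W assms in auto)
  then show False using assms(3) by simp
qed

end

section \<open>Reduction to the Fraenkel word\<close>

context desub
begin

lemma const_gap_word:
  assumes fin: "finite (range s)" and odd: "finite (oddities s)" "card (oddities s) < card (range s)"
    and noloop: "\<And>i. t i \<noteq> t (Suc i)"
    and nofreq: "\<And>b c. b \<in> range s \<Longrightarrow> c \<in> range s \<Longrightarrow> b \<noteq> c \<Longrightarrow>
      \<not> (\<exists>f. has_frequency s b f \<and> has_frequency s c f)"
  shows "\<exists>q d r. covers (\<lambda>i. t (q + i)) (range s) d r"
proof -
  obtain x where x: "x \<in> range s" "\<And>j g k. cgap t x j g \<Longrightarrow> k \<le> g \<Longrightarrow> t (j + k) = t (j + g - k)"
    using ex_palindromic_letter[OF fin odd] by blast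
  \<comment> \<open>An odd gap g spans g + 1 letters, an even number, so the palindrome would have
    two equal letters at its centre.\<close>
  have ev: "even g" if "cgap t x j g" for j g
  proof (rule ccontr)
    assume "odd g"
    then obtain h where h: "g = Suc (2 * h)" by (metis oddE Suc_eq_plus1)
    have "t (j + h) = t (j + g - h)" by (rule x(2)[OF that]) (simp add: h)
    moreover have "j + g - h = Suc (j + h)" using h by simp
    ultimately show False using noloop[of "j + h"] by simp
  qed
  obtain q where q: "t q = x" using x(1) range_t by (metis imageE)
  obtain q' where "q' \<ge> Suc q" "t q' = x" using recur_letter[OF recur_t, of "Suc q" q] q by auto
  then obtain g where g: "cgap t x q g" using ex_cgap[of t q x q'] q by auto
  obtain m where m: "g = 2 * m" using ev[OF g] by blast
  have "m > 0" using g m by (simp add: cgap_def)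
  have geq: "h = g" if "cgap t x i h" for i h
    using cgap_le_Suc[OF bal_t g that] cgap_le_Suc[OF bal_t that g] ev[OF g] ev[OF that] by presburger
  have tx: "t i = x \<longleftrightarrow> i mod (2 * m) = q mod (2 * m)" for i
    using residue_class_if_constant_gap[OF bal_t recur_t q _ geq] m \<open>m > 0\<close> by simp
  define w where "w i = t (q + i)" for i
  have Bw: "bal w" and Rw: "recur w"
    unfolding w_def using bal_shift[OF bal_t] recur_shift[OF recur_t] by auto
  have wx: "w i = x \<longleftrightarrow> 2 * m dvd i" for i
  proof -
    have "w i = x \<longleftrightarrow> (q + i) mod (2 * m) = q mod (2 * m)" using tx by (simp add: w_def)
    also have "\<dots> \<longleftrightarrow> 2 * m dvd i" using mod_eq_dvd_iff_nat[of q "q + i" "2 * m"] by auto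
    finally show ?thesis .
  qed
  have rg: "range w = range s"
    unfolding range_t[symmetric]
  proof
    show "range w \<subseteq> range t" by (auto simp: w_def)
    show "range t \<subseteq> range w"
    proof
      fix c assume "c \<in> range t"
      then obtain i where "t i = c" by auto
      then obtain j where "j \<ge> q" "t j = c" using recur_letter[OF recur_t, of q i] by auto
      then have "w (j - q) = c" by (simp add: w_def)
      then show "c \<in> range w" by auto
    qed
  qed
  \<comment> \<open>One of the two letters is \<open>a\<close> with p > 0, as otherwise the
    frequencies agree. The other one has gaps g and g + 1 in t, each with exactly one
    \<open>a\<close> inside, against \<open>cgap_same\<close>.\<close>
  have noalt: False if "u \<noteq> v" and alt: "alternate w u v" and gaps: "cgap w u i g" "cgap w u i' (Suc g)"
    "cgap w v j g" "cgap w v j' (Suc g)" for u v g i i' j j'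
  proof -
    have uvA: "u \<in> range s" "v \<in> range s"
      unfolding rg[symmetric] using gaps(1,3) by (auto simp: cgap_def)
    have bd: "\<bar>cnt t u q n - cnt t v q n\<bar> \<le> 1" for n
      using alternate_bounded[OF alt, of 0 n] unfolding w_def cnt_shift by simp
    have "\<not> ((u \<noteq> a \<or> p = 0) \<and> (v \<noteq> a \<or> p = 0))"
      using equal_frequency_transfer[OF _ _ bd] nofreq[OF uvA \<open>u \<noteq> v\<close>] by blast
    then have "p \<ge> 1" and ua: "u = a \<or> v = a" by auto
    have key: False
      if "b \<noteq> a" "alternate w b a" "cgap w b i g" "cgap w b i' (Suc g)" for b i i'
    proof -
      have "cnt w a i g = 1" "cnt w a i' (Suc g) = 1"
        using alternate_cgap_cnt[OF that(2,1)] that(3,4) by blast+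
      then have "cnt t a (q + i) g = cnt t a (q + i') (Suc g)" unfolding w_def cnt_shift by simp
      then show False
        using cgap_same[OF that(1) \<open>p \<ge> 1\<close>, of "q + i" g "q + i'" "Suc g"] that(3,4)
        unfolding w_def cgap_shift by simp
    qed
    show False
    proof (cases "v = a")
      case True
      then show False using key[of u i i'] alt gaps \<open>u \<noteq> v\<close> by simp
    next
      case False
      then show False using key[of v j j'] alternate_sym[OF alt] ua gaps by simp
    qed
  qed
  have refl: "w (2 * m * k + r) = w (2 * m * k + (2 * m - r))" if "r \<le> 2 * m" for k r
  proof -
    have "w (2 * m * k) = x" using wx by simp
    then have tx0: "t (q + 2 * m * k) = x" by (simp add: w_def)
    obtain l where "l \<ge> Suc (q + 2 * m * k)" "t l = x"
      using recur_letter[OF recur_t, of "Suc (q + 2 * m * k)" "q + 2 * m * k"] tx0 by auto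
    then obtain h where "cgap t x (q + 2 * m * k) h"
      using ex_cgap[of t "q + 2 * m * k" x l] tx0 by auto
    then have "cgap t x (q + 2 * m * k) (2 * m)" using geq m by blast
    from x(2)[OF this that] show ?thesis using that by (simp add: w_def add.assoc)
  qed
  have "\<exists>d>0. \<exists>r<d. \<forall>i. w i = c \<longleftrightarrow> i mod d = r" if "c \<in> range s" for c
  proof (rule residue_classes_if_palindromic_returns[OF Bw Rw _ \<open>m > 0\<close> wx refl])
    show "w i \<noteq> w (Suc i)" for i using noloop[of "q + i"] by (simp add: w_def)
    show "c \<in> range w" using that rg by simp
  qed (use noalt in blast)+
  then have "\<forall>c\<in>range s. \<exists>dr. snd dr < fst dr \<and> (\<forall>i. w i = c \<longleftrightarrow> i mod fst dr = snd dr)"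
    by (metis fst_conv snd_conv)
  then obtain dr where dr: "\<forall>c\<in>range s. snd (dr c) < fst (dr c) \<and> (\<forall>i. w i = c \<longleftrightarrow> i mod fst (dr c) = snd (dr c))"
    by (rule bchoice[THEN exE])
  then have "covers w (range s) (\<lambda>c. fst (dr c)) (\<lambda>c. snd (dr c))"
    unfolding covers_def using fin rg by auto
  then show ?thesis unfolding w_def[abs_def] by blast
qed

lemma episturmian_if_no_equal_frequencies:
  assumes fin: "finite (range s)" and c2: "card (range s) > 2"
    and odd: "finite (oddities s)" "card (oddities s) < card (range s)"
    and nl: "p = 0 \<Longrightarrow> \<forall>i. s i \<noteq> s (Suc i)"
    and nofreq: "\<And>b c. b \<in> range s \<Longrightarrow> c \<in> range s \<Longrightarrow> b \<noteq> c \<Longrightarrow>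
      \<not> (\<exists>f. has_frequency s b f \<and> has_frequency s c f)"
  shows "episturmian s"
proof -
  have aA: "a \<in> range s" using long_run by (metis rangeI le0)
  have noloop: "t i \<noteq> t (Suc i)" for i
  proof
    assume eq: "t i = t (Suc i)"
    show False
    proof (cases "p = 0")
      case True
      then have "e (Suc i) = Suc (e i)" by (simp add: e_Suc)
      then show False using nl[rule_format, OF True, of "e i"] eq t[of i] t[of "Suc i"] by simp
    next
      case False
      have "t i \<noteq> a" using no_aa_t[of i] eq by simp
      have "\<not> range s \<subseteq> {a, t i}"
        using card_mono[of "{a, t i}" "range s"] c2 card_insert_le_m1[of 2 "{t i}" a] by (auto simp: card_insert_if split: if_splits)
      then obtain c where "c \<in> range s" "c \<noteq> a" "c \<noteq> t i" by blast
      then show False using noloop_t[of c "t i" i] \<open>t i \<noteq> a\<close> False eq by simp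
    qed
  qed
  obtain q d r where cov: "covers (\<lambda>i. t (q + i)) (range s) d r"
    using const_gap_word[OF fin odd noloop nofreq] by blast
  define w where "w i = t (q + i)" for i
  have cov: "covers w (range s) d r" using cov by (simp add: w_def[abs_def])
  \<comment> \<open>Letters with equal constant gaps alternate, so their frequencies in s agree
    unless deletion changed one of the counts.\<close>
  have co: "p \<ge> 1 \<and> (b = a \<or> c = a)" if bc: "b \<in> range s" "c \<in> range s" "b \<noteq> c" "d b = d c" for b c
  proof (rule ccontr)
    assume "\<not> ?thesis"
    then have ne: "b \<noteq> a \<or> p = 0" "c \<noteq> a \<or> p = 0" by auto
    have cl: "r x < d x" "\<And>i. w i = x \<longleftrightarrow> i mod d x = r x" if "x \<in> range s" for x
      using cov that by (auto simp: covers_def)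
    have "alternate w b c"
      using alternate_if_same_modulus[OF bc(3) cl(1)[OF bc(1)] _ cl(2)[OF bc(1)], of "r c"]
        cl[OF bc(2)] bc(4) by simp
    then have "\<bar>cnt t b q n - cnt t c q n\<bar> \<le> 1" for n
      using alternate_bounded[of w b c 0 n] unfolding w_def cnt_shift by simp
    then show False using equal_frequency_transfer[OF ne] nofreq[OF bc(1-3)] by blast
  qed
  obtain n where n: "card (range s) = Suc n" "n \<ge> 2"
    using c2 by (cases "card (range s)") auto
  \<comment> \<open>With p = 0 no two gaps coincide, so any letter may play the exceptional part in
    \<open>covers_ruler\<close>. All letters then get the gap 2^n, a coincidence after all.\<close>
  have "p \<ge> 1"
  proof (rule ccontr)
    assume p0: "\<not> p \<ge> 1"
    then have no: "b = c" if "b \<in> range s" "c \<in> range s" "d b = d c" for b c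
      using co[OF that(1,2) _ that(3)] by blast
    have "d b = 2 ^ n" if "b \<in> range s" for b
      using covers_ruler[OF cov that _ n(1)] no by blast
    then have "b = c" if "b \<in> range s" "c \<in> range s" for b c
      using no that by simp
    then have "card (range s) \<le> 1" using card_le_Suc0_iff_eq[OF fin] by (simp add: One_nat_def)
    then show False using c2 by simp
  qed
  obtain z C where C: "inj_on C {..n}" "C n = a"
    "\<And>i k. k < n \<Longrightarrow> lv k i \<Longrightarrow> w (z + i) = C k" "\<And>i. 2 ^ n dvd i \<Longrightarrow> w (z + i) = a"
    using covers_ruler[OF cov aA _ n(1)] co by blast
  have Cne: "C k \<noteq> C l" if "k \<le> n" "l \<le> n" "k \<noteq> l" for k l
    using inj_onD[OF C(1), of k l] that by auto
  define Z where "Z = q + z"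
  define D :: nat where "D = 2 ^ n"
  have tC: "t (Z + i) = C k" if "k < n" "lv k i" for i k
    using C(3)[OF that] by (simp add: w_def Z_def add.assoc)
  have tA: "t (Z + i) = a" if "D dvd i" for i
    using C(4)[of i] that by (simp add: w_def Z_def D_def add.assoc)
  have Dpos: "D > 0" and D4: "4 dvd D"
  proof -
    have "(2::nat) ^ 2 dvd 2 ^ n" using n by (intro le_imp_power_dvd)
    then show "4 dvd D" by (simp add: D_def)
  qed (simp add: D_def)
  have tne: "t (Z + i) \<noteq> a" if "\<not> D dvd i" for i
  proof -
    have "i > 0" using that by (intro gr0I) auto
    then obtain k where k: "lv k i" using ex_lv by blast
    have "k < n"
    proof (rule ccontr)
      assume "\<not> k < n"
      then have "D dvd 2 ^ k" unfolding D_def by (intro le_imp_power_dvd) simp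
      then show False using k that unfolding lv_def by (meson dvd_trans)
    qed
    then show ?thesis using tC[OF _ k] Cne[of k n] C(2) by simp
  qed
  have todd: "t (Z + i) = C 0" if "odd i" for i
    using tC[of 0 i] that n by (simp add: lv_def)
  have b: "C 0 \<noteq> a" using Cne[of 0 n] C(2) n by simp
  \<comment> \<open>Two consecutive letters \<open>C 0\<close> of t enclose \<open>C 1\<close> near
    Z + 2 and \<open>a\<close> near Z + D, which gives the gaps 2(p + 1) and p + 2 in s.\<close>
  have "p \<le> 1"
  proof -
    obtain D' where D': "D = Suc D'" using Dpos by (cases D) auto
    have oddD': "odd D'" using D4 D' by presburger
    have gap2: "cgap t c i 2" if "t i = c" "t (Suc i) \<noteq> c" "t (Suc (Suc i)) = c" for c i
    proof -
      have "t (i + k) \<noteq> c" if k: "0 < k \<and> k < 2" for k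
      proof -
        have "k = 1" using k by simp
        then show ?thesis using \<open>t (Suc i) \<noteq> c\<close> by simp
      qed
      then show ?thesis unfolding cgap_def using \<open>t i = c\<close> \<open>t (Suc (Suc i)) = c\<close> by simp
    qed
    have t1: "t (Suc Z) = C 0" using todd[of 1] by simp
    have "lv 1 2" by (simp add: lv_def)
    then have "t (Z + 2) = C 1" using tC[of 1 2] n by simp
    then have t2: "t (Suc (Suc Z)) = C 1" by (simp add: numeral_2_eq_2)
    have "t (Z + Suc (Suc (Suc 0))) = C 0" by (rule todd) simp
    then have t3: "t (Suc (Suc (Suc Z))) = C 0" by simp
    have C1: "C 1 \<noteq> a" "C 1 \<noteq> C 0" using Cne[of 1 n] Cne[of 1 0] C(2) n by simp_all
    have ge: "cgap t (C 0) (Suc Z) 2" by (rule gap2) (use t1 t2 t3 C1 in auto)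
    have u1: "t (Z + D') = C 0" by (rule todd) fact
    have "t (Z + D) = a" by (rule tA) simp
    then have u2: "t (Suc (Z + D')) = a" using D' by simp
    have "t (Z + Suc (Suc D')) = C 0" by (rule todd) (use oddD' in simp)
    then have u3: "t (Suc (Suc (Z + D'))) = C 0" by simp
    have le: "cgap t (C 0) (Z + D') 2" by (rule gap2) (use u1 u2 u3 b in auto)
    have "e (Suc Z + 2) - e (Suc Z) = 2 * Suc p"
      using t1 t2 b C1 by (simp add: e_Suc numeral_2_eq_2)
    moreover have "e (Z + D' + 2) - e (Z + D') = Suc (Suc p)"
      using u1 u2 b by (simp add: e_Suc numeral_2_eq_2)
    ultimately show ?thesis
      using cgap_le_Suc[OF bal_s cgap_transfer[OF b le] cgap_transfer[OF b ge]] by simp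
  qed
  then have p1: "p = 1" using \<open>p \<ge> 1\<close> by simp
  \<comment> \<open>For p = 1, a block of D letters of t with exactly one \<open>a\<close> occupies
    2(D - 1) + 1 positions of s.\<close>
  define N where "N = 2 * D - 1"
  have N: "Suc N = 2 ^ Suc n" using Dpos by (simp add: N_def D_def)
  have step: "e (Z + D * K + j) = e (Z + D * K) + 2 * j - 1" if "1 \<le> j" "j \<le> D" for K j
  proof -
    obtain j' where j': "j = Suc j'" using \<open>1 \<le> j\<close> by (cases j) auto
    have "cnt t a (Z + D * K) j = of_bool (t (Z + D * K) = a) + cnt t a (Suc (Z + D * K)) j'"
      unfolding j' by (rule cnt_Suc_left)
    moreover have "t (Z + D * K) = a" using tA[of "D * K"] by simp
    moreover have "cnt t a (Suc (Z + D * K)) j' = 0"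
    proof (rule cnt_eq_0)
      fix l assume l: "l < j'"
      have "\<not> D dvd Suc l" using l j' that by (auto dest: dvd_imp_le)
      then have "\<not> D dvd D * K + Suc l" by (simp only: dvd_add_right_iff dvd_triv_left not_False_eq_True)
      then show "t (Suc (Z + D * K) + l) \<noteq> a" using tne[of "D * K + Suc l"] by (simp add: add.assoc)
    qed
    ultimately have "cnt t a (Z + D * K) j = 1" by simp
    then show ?thesis using e_add[of "Z + D * K" j] p1 that by simp
  qed
  have block: "e (Z + D * K) = e Z + N * K" for K
  proof (induction K)
    case (Suc K)
    have "e (Z + D * Suc K) = e (Z + D * K + D)" by (simp add: algebra_simps)
    also have "\<dots> = e (Z + D * K) + 2 * D - 1" using step[of D K] Dpos by simp
    finally show ?case using Suc Dpos by (simp add: N_def)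
  qed simp
  \<comment> \<open>In s the letter of t at offset j > 0 of a block has index 2j within the period,
    so levels rise by one. The odd indices carry \<open>a\<close>: index 1 is the \<open>a\<close>
    of t, the others are the restored letters.\<close>
  define L where "L k = (case k of 0 \<Rightarrow> a | Suc k \<Rightarrow> C k)" for k
  interpret rw: ruler_word "\<lambda>i. s (e Z + i)" "Suc n" N L
  proof
    show "1 \<le> Suc n" by simp
    show "Suc N = 2 ^ Suc n" by (rule N)
    show "inj_on L {..<Suc n}"
    proof (rule inj_onI)
      fix k l assume kl: "k \<in> {..<Suc n}" "l \<in> {..<Suc n}" "L k = L l"
      show "k = l"
      proof (cases k; cases l)
        fix k' assume "k = Suc k'" "l = 0"
        then show ?thesis using kl Cne[of k' n] C(2) by (simp add: L_def)
      next
        fix l' assume "k = 0" "l = Suc l'"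
        then show ?thesis using kl Cne[of l' n] C(2) by (simp add: L_def)
      next
        fix k' l' assume "k = Suc k'" "l = Suc l'"
        then show ?thesis using kl Cne[of k' l'] by (auto simp: L_def)
      qed simp
    qed
    fix k i
    assume k: "lv k (Suc (i mod N))"
    define K where "K = i div N"
    define \<rho> where "\<rho> = i mod N"
    have "N > 0" using Dpos by (simp add: N_def)
    then have \<rho>: "\<rho> < N" by (simp add: \<rho>_def)
    have i: "i = N * K + \<rho>" by (simp add: K_def \<rho>_def)
    have ei: "e Z + i = e (Z + D * K) + \<rho>" using block[of K] i by simp
    show "s (e Z + i) = L k"
    proof (cases "even \<rho>")
      case True
      then have "lv 0 (Suc \<rho>)" by (simp add: lv_def)
      then have "k = 0" using lv_unique k \<rho>_def by blast
      have "s (e Z + i) = a"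
      proof (cases "\<rho> = 0")
        case True
        then show ?thesis using ei tA[of "D * K"] t[of "Z + D * K"] by simp
      next
        case False
        then obtain j where j: "\<rho> = 2 * j" "1 \<le> j" using True by (auto elim!: evenE)
        then have jD: "j < D" using \<rho> by (simp add: N_def)
        then have "\<not> D dvd j" using j by (auto dest: dvd_imp_le)
        then have "\<not> D dvd D * K + j" by (simp only: dvd_add_right_iff dvd_triv_left not_False_eq_True)
        then have "t (Z + D * K + j) \<noteq> a" using tne[of "D * K + j"] by (simp add: add.assoc)
        then have "s (e (Z + D * K + j) + 1) = a" using run[of "e (Z + D * K + j)" 1] t p1 by simp
        moreover have "e Z + i = e (Z + D * K + j) + 1" using ei step[of j K] j jD by simp
        ultimately show ?thesis by simp
      qed
      then show ?thesis using \<open>k = 0\<close> by (simp add: L_def)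
    next
      case False
      then obtain j' where j': "\<rho> = 2 * j' + 1" by (metis oddE)
      define j where "j = Suc j'"
      have j: "Suc \<rho> = 2 * j" "1 \<le> j" using j' by (simp_all add: j_def)
      then have jD: "j < D" using \<rho> by (simp add: N_def)
      obtain k' where k': "lv k' j" using ex_lv[of j] j by auto
      have "k' < n" using lv_less[OF k'] jD j by (simp add: D_def)
      have "lv (Suc k') (Suc \<rho>)" using k' j by (simp only: lv_double)
      then have "k = Suc k'" using lv_unique k \<rho>_def by blast
      have "lv k' (D * K + j)"
        using lv_add_dvd[of n "D * K" k' j] k' \<open>k' < n\<close> by (simp add: D_def add.commute)
      then have "t (Z + D * K + j) = C k'" using tC[OF \<open>k' < n\<close>, of "D * K + j"] by (simp add: add.assoc)
      moreover have "e Z + i = e (Z + D * K + j)" using ei step[of j K] j jD by simp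
      ultimately show ?thesis using t \<open>k = Suc k'\<close> by (simp add: L_def)
    qed
  qed
  show ?thesis
    using rw.episturmian_ruler episturmian_cong[OF factors_shift[OF recur_s]] by blast
qed

end

text \<open>The letter \<open>a\<close> is a doubled letter if there is one, and arbitrary
  otherwise. Its runs are bounded because another letter occurs in every window of some fixed
  length; p + 1 is the longest run.\<close>

lemma ex_desub:
  assumes "bal s" "recur s" "finite (range s)" "card (range s) > 2"
  shows "\<exists>a p e t. desub s a p e t \<and> (p = 0 \<longrightarrow> (\<forall>i. s i \<noteq> s (Suc i)))"
proof -
  obtain a where aA: "a \<in> range s" and a: "(\<exists>i. s i = s (Suc i)) \<Longrightarrow> \<exists>i. s i = a \<and> s (Suc i) = a"
    by (metis rangeI)
  define R where "R n \<longleftrightarrow> (\<exists>i. \<forall>q<n. s (i + q) = a)" for n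
  have "\<not> range s \<subseteq> {a}" using card_mono[of "{a}" "range s"] assms(4) by auto
  then obtain i0 where i0: "s i0 \<noteq> a" by auto
  obtain i1 where i1: "i1 \<ge> Suc i0" "s i1 = s i0" using recur_letter[OF assms(2)] by blast
  have "\<not> R (Suc (i1 - i0))"
  proof
    assume "R (Suc (i1 - i0))"
    then obtain i where i: "\<forall>q<Suc (i1 - i0). s (i + q) = a" by (auto simp: R_def)
    obtain k where "k \<le> i1 - i0" "s (i + k) = s i0"
      using bal_window[OF assms(1), of i0 "s i0" "i1 - i0" i] i1 by auto
    then show False using i i0 by auto
  qed
  define n where "n = (LEAST n. \<not> R n)"
  have nR: "\<not> R n" unfolding n_def by (rule LeastI) fact
  have Rn: "R k" if "k < n" for k using not_less_Least[of k "\<lambda>n. \<not> R n"] that by (auto simp: n_def)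
  have "R 0" "R 1" using aA by (auto simp: R_def)
  then have "n \<noteq> 0" "n \<noteq> 1" using nR by metis+
  then obtain p where p: "n = Suc (Suc p)" by (metis One_nat_def not0_implies_Suc)
  obtain L where L: "\<forall>q\<le>p. s (L + q) = a" using Rn[of "Suc p"] p by (auto simp: R_def less_Suc_eq_le)
  \<comment> \<open>Otherwise q + 1 letters with both ends different from \<open>a\<close> contain
    at most q - 1 letters \<open>a\<close>, while the run at L contains a window of q + 1 letters
    \<open>a\<close>.\<close>
  have run: "s (i + q) = a" if "s i \<noteq> a" "1 \<le> q" "q \<le> p" for i q
  proof (rule ccontr)
    assume "s (i + q) \<noteq> a"
    obtain q' where q': "q = Suc q'" using \<open>1 \<le> q\<close> by (cases q) auto
    have "cnt s a L (Suc q) = int (Suc q)" by (rule cnt_all) (use L that in auto)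
    moreover have "cnt s a i (Suc q) = cnt s a (Suc i) q'"
      using that(1) \<open>s (i + q) \<noteq> a\<close> cnt_Suc_left[of s a i q] cnt_Suc[of s a "Suc i" q'] q' by simp
    ultimately show False
      using balD[OF assms(1), of a L "Suc q" i] cnt_le[of s a "Suc i" q'] q' by simp
  qed
  \<comment> \<open>The starting letter is not \<open>a\<close> and has p predecessors. These are
    all \<open>a\<close>, since \<open>run\<close> applied to any other letter there would put
    \<open>a\<close> at e0.\<close>
  obtain e0 where e0: "e0 \<ge> p" "s e0 = s i0" using recur_letter[OF assms(2)] by blast
  define e where "e = rec_nat e0 (\<lambda>_ x. x + (if s x = a then 1 else Suc p))"
  have "desub s a p e (\<lambda>j. s (e j))"
  proof
    show "\<exists>q\<le>Suc p. s (i + q) \<noteq> a" for i using nR p by (auto simp: R_def less_Suc_eq_le)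
    show "s (e 0 - q) = a" if "1 \<le> q" "q \<le> p" for q
    proof (rule ccontr)
      assume "s (e 0 - q) \<noteq> a"
      then have "s (e 0 - q + q) = a" using run that by blast
      then show False using that e0 i0 by (simp add: e_def)
    qed
  qed (use assms run L e0 i0 in \<open>auto simp: e_def\<close>)
  moreover have "\<forall>i. s i \<noteq> s (Suc i)" if "p = 0"
  proof (rule ccontr)
    assume "\<not> ?thesis"
    then obtain i where "s i = a" "s (Suc i) = a" using a by blast
    then have "R 2" by (auto simp: R_def less_2_cases_iff intro!: exI[of _ i])
    then show False using nR p that by (simp add: numeral_2_eq_2)
  qed
  ultimately show ?thesis by blast
qed

theorem theorem5p15:
  fixes s :: "nat \<Rightarrow> 'a" and A :: "'a set"
  assumes "range s = A" and "finite A" and "card A > 2"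
    and "recurrent s" and "balanced s"
    and "finite (oddities s)" and "card (oddities s) < card A"
  shows "episturmian s \<or>
    (\<exists>a\<in>A. \<exists>b\<in>A. a \<noteq> b \<and> (\<exists>f. has_frequency s a f \<and> has_frequency s b f))"
proof (rule disjCI)
  assume nofreq: "\<not> (\<exists>a\<in>A. \<exists>b\<in>A. a \<noteq> b \<and> (\<exists>f. has_frequency s a f \<and> has_frequency s b f))"
  obtain a p e t where "desub s a p e t" and p: "p = 0 \<longrightarrow> (\<forall>i. s i \<noteq> s (Suc i))"
    using ex_desub[OF balanced_imp_bal[OF assms(5)] recurrent_imp_recur[OF assms(4)]] assms(1-3) by auto
  then interpret desub s a p e t by simp
  show "episturmian s"
    by (rule episturmian_if_no_equal_frequencies) (use assms p nofreq in blast)+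
qed

end
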